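(* For any primitive $P_{X,Y}$, $\Delta_{P_{X,Y}}\ge\Delta_{P_{X\searrow Y,\,Y\searrow X}}$.
   Context: A primitive is a joint distribution $P_{X,Y}$ on finite sets. Dependent part: with $f_X(x):=P_{Y|X=x}$, $X\searrow Y:=f_X(X)$; with $f_Y(y):=P_{X|Y=y}$, $Y\searrow X:=f_Y(Y)$; $P_{X\searrow Y,Y\searrow X}$ is their joint distribution (a primitive on finite sets, the values encoded as computational basis labels). For a primitive, $\mathcal H_A,\mathcal H_B$ have computational bases indexed by the value sets of $X$, $Y$, and $\mathcal H_{A'},\mathcal H_{B'}$ are finite-dimensional (possibly trivial) work spaces. For a pure state on $AA'BB'$, $X$ (resp. $Y$) is the outcome of measuring $A$ (resp. $B$) in the computational basis; entropic quantities are evaluated on the state obtained by measuring exactly the registers named by $X$ or $Y$ and tracing out unmentioned registers; $S(P;Q)=S(P)+S(Q)-S(PQ)$ (von Neumann); $I$ is Shannon mutual information. An embedding of $P_{X,Y}$ is a pure state with $(X,Y)\sim P_{X,Y}$ and $S(X;YB')=S(XA';Y)=I(X;Y)$; its leakage is $\Delta_\psi(P_{X,Y})=\max\{S(X;BB')-I(X;Y),S(AA';Y)-I(X;Y)\}$. The leakage of a primitive is $\Delta_{P_{X,Y}}:=\min_\psi\Delta_\psi(P_{X,Y})$ over all embeddings $|\psi\rangle$ of $P_{X,Y}$ (the minimum exists). *)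

theory Defs
  imports Complex_Main
begin

definition primitive :: "'a set \<Rightarrow> 'b set \<Rightarrow> ('a \<Rightarrow> 'b \<Rightarrow> real) \<Rightarrow> bool" where
  "primitive SX SY P \<longleftrightarrow> finite SX \<and> finite SY \<and>
     (\<forall>x\<in>SX. \<forall>y\<in>SY. P x y \<ge> 0) \<and> (\<Sum>x\<in>SX. \<Sum>y\<in>SY. P x y) = 1"

definition ent_term :: "real \<Rightarrow> real" where
  "ent_term p = (if p \<le> 0 then 0 else - p * log 2 p)"

definition margX :: "'b set \<Rightarrow> ('a \<Rightarrow> 'b \<Rightarrow> real) \<Rightarrow> 'a \<Rightarrow> real" where
  "margX SY P x = (\<Sum>y\<in>SY. P x y)"

definition margY :: "'a set \<Rightarrow> ('a \<Rightarrow> 'b \<Rightarrow> real) \<Rightarrow> 'b \<Rightarrow> real" where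
  "margY SX P y = (\<Sum>x\<in>SX. P x y)"

definition shannon_mi :: "'a set \<Rightarrow> 'b set \<Rightarrow> ('a \<Rightarrow> 'b \<Rightarrow> real) \<Rightarrow> real" where
  "shannon_mi SX SY P =
     (\<Sum>x\<in>SX. ent_term (margX SY P x)) + (\<Sum>y\<in>SY. ent_term (margY SX P y))
     - (\<Sum>x\<in>SX. \<Sum>y\<in>SY. ent_term (P x y))"

text \<open>f_X(x) = P_{Y|X=x} (a distribution on SY, as a function, zero off SY),
  defined for x with positive probability.\<close>
definition condY :: "'b set \<Rightarrow> ('a \<Rightarrow> 'b \<Rightarrow> real) \<Rightarrow> 'a \<Rightarrow> ('b \<Rightarrow> real)" where
  "condY SY P x = (\<lambda>y. if y \<in> SY then P x y / margX SY P x else 0)"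

definition condX :: "'a set \<Rightarrow> ('a \<Rightarrow> 'b \<Rightarrow> real) \<Rightarrow> 'b \<Rightarrow> ('a \<Rightarrow> real)" where
  "condX SX P y = (\<lambda>x. if x \<in> SX then P x y / margY SX P y else 0)"

definition depX_set :: "'a set \<Rightarrow> 'b set \<Rightarrow> ('a \<Rightarrow> 'b \<Rightarrow> real) \<Rightarrow> ('b \<Rightarrow> real) set" where
  "depX_set SX SY P = condY SY P ` {x\<in>SX. margX SY P x > 0}"

definition depY_set :: "'a set \<Rightarrow> 'b set \<Rightarrow> ('a \<Rightarrow> 'b \<Rightarrow> real) \<Rightarrow> ('a \<Rightarrow> real) set" where
  "depY_set SX SY P = condX SX P ` {y\<in>SY. margY SX P y > 0}"

definition dep_dist :: "'a set \<Rightarrow> 'b set \<Rightarrow> ('a \<Rightarrow> 'b \<Rightarrow> real)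
    \<Rightarrow> ('b \<Rightarrow> real) \<Rightarrow> ('a \<Rightarrow> real) \<Rightarrow> real" where
  "dep_dist SX SY P u v =
     (\<Sum>x\<in>{x\<in>SX. margX SY P x > 0 \<and> condY SY P x = u}.
        \<Sum>y\<in>{y\<in>SY. margY SX P y > 0 \<and> condX SX P y = v}. P x y)"

text \<open>A Hermitian positive semidefinite matrix rho indexed by a finite set I has a
  spectral decomposition rho = \<Sum>_i lam_i u_i u_i^* with (u_i)_{i\<in>I} an orthonormal basis
  of C^I; its von Neumann entropy is -\<Sum>_i lam_i log lam_i (with 0 log 0 = 0).\<close>
definition vn_entropy :: "'i set \<Rightarrow> ('i \<Rightarrow> 'i \<Rightarrow> complex) \<Rightarrow> real" where
  "vn_entropy I rho = (SOME s. \<exists>(lam :: 'i \<Rightarrow> real) (u :: 'i \<Rightarrow> 'i \<Rightarrow> complex).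
      (\<forall>i\<in>I. \<forall>k\<in>I. (\<Sum>j\<in>I. u i j * cnj (u k j)) = (if i = k then 1 else 0)) \<and>
      (\<forall>j\<in>I. \<forall>l\<in>I. rho j l = (\<Sum>i\<in>I. complex_of_real (lam i) * u i j * cnj (u i l))) \<and>
      s = (\<Sum>i\<in>I. ent_term (lam i)))"

text \<open>Each of the four registers A, A', B, B' is either measured in the computational
  basis (Meas), kept as a quantum register (Keep) or traced out (Tr).
  A pure state is psi :: 'a \<times> nat \<times> 'b \<times> nat \<Rightarrow> complex, where the A-index ranges over SX,
  the A'-index over {..<dA}, the B-index over SY and the B'-index over {..<dB}.\<close>

datatype mode = Meas | Keep | Tr

definition keep_set :: "mode \<Rightarrow> 'c set \<Rightarrow> 'c set" where
  "keep_set m S = (if m = Tr then {undefined} else S)"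

definition tr_set :: "mode \<Rightarrow> 'c set \<Rightarrow> 'c set" where
  "tr_set m S = (if m = Tr then S else {undefined})"

definition mrg :: "mode \<Rightarrow> 'c \<Rightarrow> 'c \<Rightarrow> 'c" where
  "mrg m i t = (if m = Tr then t else i)"

definition dg :: "mode \<Rightarrow> 'c \<Rightarrow> 'c \<Rightarrow> bool" where
  "dg m i j \<longleftrightarrow> (m \<noteq> Meas \<or> i = j)"

type_synonym modes = "mode \<times> mode \<times> mode \<times> mode"

definition red_idx :: "modes \<Rightarrow> 'a set \<Rightarrow> nat \<Rightarrow> 'b set \<Rightarrow> nat \<Rightarrow> ('a \<times> nat \<times> 'b \<times> nat) set" where
  "red_idx M SX dA SY dB = (case M of (m1, m2, m3, m4) \<Rightarrow>
     keep_set m1 SX \<times> keep_set m2 {..<dA} \<times> keep_set m3 SY \<times> keep_set m4 {..<dB})"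

definition tr_idx :: "modes \<Rightarrow> 'a set \<Rightarrow> nat \<Rightarrow> 'b set \<Rightarrow> nat \<Rightarrow> ('a \<times> nat \<times> 'b \<times> nat) set" where
  "tr_idx M SX dA SY dB = (case M of (m1, m2, m3, m4) \<Rightarrow>
     tr_set m1 SX \<times> tr_set m2 {..<dA} \<times> tr_set m3 SY \<times> tr_set m4 {..<dB})"

definition red_mat :: "modes \<Rightarrow> 'a set \<Rightarrow> nat \<Rightarrow> 'b set \<Rightarrow> nat \<Rightarrow> ('a \<times> nat \<times> 'b \<times> nat \<Rightarrow> complex)
    \<Rightarrow> ('a \<times> nat \<times> 'b \<times> nat) \<Rightarrow> ('a \<times> nat \<times> 'b \<times> nat) \<Rightarrow> complex" where
  "red_mat M SX dA SY dB psi i j = (case M of (m1, m2, m3, m4) \<Rightarrow>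
     (case i of (i1, i2, i3, i4) \<Rightarrow> case j of (j1, j2, j3, j4) \<Rightarrow>
       if dg m1 i1 j1 \<and> dg m2 i2 j2 \<and> dg m3 i3 j3 \<and> dg m4 i4 j4 then
         (\<Sum>(t1, t2, t3, t4)\<in>tr_idx M SX dA SY dB.
            psi (mrg m1 i1 t1, mrg m2 i2 t2, mrg m3 i3 t3, mrg m4 i4 t4) *
            cnj (psi (mrg m1 j1 t1, mrg m2 j2 t2, mrg m3 j3 t3, mrg m4 j4 t4)))
       else 0))"

definition Sred :: "modes \<Rightarrow> 'a set \<Rightarrow> nat \<Rightarrow> 'b set \<Rightarrow> nat \<Rightarrow> ('a \<times> nat \<times> 'b \<times> nat \<Rightarrow> complex) \<Rightarrow> real" where
  "Sred M SX dA SY dB psi = vn_entropy (red_idx M SX dA SY dB) (red_mat M SX dA SY dB psi)"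

text \<open>S(P;Q) = S(P) + S(Q) - S(PQ), where P uses the registers in M1, Q those in M2
  and PQ those in M12.\<close>
definition Smi :: "modes \<Rightarrow> modes \<Rightarrow> modes \<Rightarrow> 'a set \<Rightarrow> nat \<Rightarrow> 'b set \<Rightarrow> nat
    \<Rightarrow> ('a \<times> nat \<times> 'b \<times> nat \<Rightarrow> complex) \<Rightarrow> real" where
  "Smi M1 M2 M12 SX dA SY dB psi =
     Sred M1 SX dA SY dB psi + Sred M2 SX dA SY dB psi - Sred M12 SX dA SY dB psi"

definition S_X_YB' where
  "S_X_YB' = Smi (Meas, Tr, Tr, Tr) (Tr, Tr, Meas, Keep) (Meas, Tr, Meas, Keep)"
definition S_XA'_Y where
  "S_XA'_Y = Smi (Meas, Keep, Tr, Tr) (Tr, Tr, Meas, Tr) (Meas, Keep, Meas, Tr)"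
definition S_X_BB' where
  "S_X_BB' = Smi (Meas, Tr, Tr, Tr) (Tr, Tr, Keep, Keep) (Meas, Tr, Keep, Keep)"
definition S_AA'_Y where
  "S_AA'_Y = Smi (Keep, Keep, Tr, Tr) (Tr, Tr, Meas, Tr) (Keep, Keep, Meas, Tr)"

text \<open>A pure state on A A' B B' with dim A' = dA \<ge> 1, dim B' = dB \<ge> 1 (trivial = 1),
  normalised, whose computational-basis measurement of A, B has law P, and
  S(X;YB') = S(XA';Y) = I(X;Y).\<close>
definition is_embedding :: "'a set \<Rightarrow> 'b set \<Rightarrow> ('a \<Rightarrow> 'b \<Rightarrow> real) \<Rightarrow> nat \<Rightarrow> nat
    \<Rightarrow> ('a \<times> nat \<times> 'b \<times> nat \<Rightarrow> complex) \<Rightarrow> bool" where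
  "is_embedding SX SY P dA dB psi \<longleftrightarrow> dA \<ge> 1 \<and> dB \<ge> 1 \<and>
     (\<forall>x\<in>SX. \<forall>y\<in>SY. (\<Sum>a<dA. \<Sum>b<dB. (cmod (psi (x, a, y, b)))\<^sup>2) = P x y) \<and>
     S_X_YB' SX dA SY dB psi = shannon_mi SX SY P \<and>
     S_XA'_Y SX dA SY dB psi = shannon_mi SX SY P"

definition emb_leakage :: "'a set \<Rightarrow> 'b set \<Rightarrow> ('a \<Rightarrow> 'b \<Rightarrow> real) \<Rightarrow> nat \<Rightarrow> nat
    \<Rightarrow> ('a \<times> nat \<times> 'b \<times> nat \<Rightarrow> complex) \<Rightarrow> real" where
  "emb_leakage SX SY P dA dB psi =
     max (S_X_BB' SX dA SY dB psi - shannon_mi SX SY P) (S_AA'_Y SX dA SY dB psi - shannon_mi SX SY P)"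

text \<open>Leakage of a primitive: minimum (here: infimum, which is attained) over all embeddings.\<close>
definition prim_leakage :: "'a set \<Rightarrow> 'b set \<Rightarrow> ('a \<Rightarrow> 'b \<Rightarrow> real) \<Rightarrow> real" where
  "prim_leakage SX SY P =
     Inf {emb_leakage SX SY P dA dB psi | dA dB psi. is_embedding SX SY P dA dB psi}"

end

theory Submission
  imports
    Defs
    "Jordan_Normal_Form.Char_Poly"
    "HOL-Computational_Algebra.Fundamental_Theorem_Algebra"
    "HOL-Library.FuncSet"
begin

text \<open>
  Let \<open>\<psi>\<close> be an embedding of \<open>P\<close>. Group the values \<open>y\<close> by their conditional law \<open>v = P(X|Y=y)\<close>,
  choose one representative \<open>w v\<close> of each class independently with probability \<open>P(y|v)\<close>, and let
  \<open>\<psi>\<^sub>w\<close> be the state keeping only the branches \<open>y = w v\<close>, rescaled to have the right law.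
  On average over \<open>w\<close> the reduced state of \<open>AA'\<close> is unchanged, and so are the averaged entropies of
  the blocks conditioned on \<open>X\<close> and \<open>Y\<close>. Concavity of the entropy shows that some \<open>\<psi>\<^sub>w\<close> leaks at
  most as much as \<open>\<psi>\<close>; the embedding condition is an equality case of concavity, which averaging forces
  for every single \<open>w\<close>. Doing the same on Alice's side gives an embedding of the dependent part.

  All entropies enter through the excess \<open>S(\<rho>) - S(tr \<rho>)\<close> of an unnormalised state, which is
  superadditive and homogeneous. The embedding conditions say that the excess is additive over the
  outcomes; together with the Schmidt decomposition they make both leakages equal to the
  excess of \<open>\<rho>\<close> on \<open>AA'\<close> minus the total excess of the blocks given \<open>(x,y)\<close>, minus \<open>I(X;Y)\<close>.
\<close>

section \<open>Spectral theorem for Hermitian matrices on a finite index set\<close>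

definition orthonormal :: "'i set \<Rightarrow> ('i \<Rightarrow> 'i \<Rightarrow> complex) \<Rightarrow> bool" where
  "orthonormal J u \<longleftrightarrow>
     (\<forall>i\<in>J. \<forall>k\<in>J. (\<Sum>j\<in>J. u i j * cnj (u k j)) = (if i = k then 1 else 0))"

definition hermitian_on :: "'i set \<Rightarrow> ('i \<Rightarrow> 'i \<Rightarrow> complex) \<Rightarrow> bool" where
  "hermitian_on J M \<longleftrightarrow> (\<forall>j\<in>J. \<forall>l\<in>J. M l j = cnj (M j l))"

lemma hermitian_onD: "hermitian_on J M \<Longrightarrow> j \<in> J \<Longrightarrow> l \<in> J \<Longrightarrow> cnj (M j l) = M l j"
  by (metis hermitian_on_def)

definition qform :: "'i set \<Rightarrow> ('i \<Rightarrow> 'i \<Rightarrow> complex) \<Rightarrow> ('i \<Rightarrow> complex) \<Rightarrow> complex" where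
  "qform J M w = (\<Sum>j\<in>J. \<Sum>l\<in>J. cnj (w j) * M j l * w l)"

definition psd :: "'i set \<Rightarrow> ('i \<Rightarrow> 'i \<Rightarrow> complex) \<Rightarrow> bool" where
  "psd J M \<longleftrightarrow> hermitian_on J M \<and> (\<forall>w. Re (qform J M w) \<ge> 0)"

text \<open>These are the two conditions on a decomposition in \<open>vn_entropy_def\<close>, with
  the eigenvectors as the rows of \<open>u\<close>.\<close>

definition spectral :: "'i set \<Rightarrow> ('i \<Rightarrow> 'i \<Rightarrow> complex) \<Rightarrow> ('i \<Rightarrow> real) \<Rightarrow> ('i \<Rightarrow> 'i \<Rightarrow> complex) \<Rightarrow> bool" where
  "spectral J M lam u \<longleftrightarrow> orthonormal J u \<and>
     (\<forall>j\<in>J. \<forall>l\<in>J. M j l = (\<Sum>i\<in>J. complex_of_real (lam i) * u i j * cnj (u i l)))"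

lemma sum_delta_mult:
  fixes f :: "'i \<Rightarrow> 'c::semiring_1"
  assumes "finite J"
  shows "(\<Sum>j\<in>J. (if i = j then 1 else 0) * f j) = (if i \<in> J then f i else 0)"
    and "(\<Sum>j\<in>J. (if j = i then 1 else 0) * f j) = (if i \<in> J then f i else 0)"
    and "(\<Sum>j\<in>J. f j * (if i = j then 1 else 0)) = (if i \<in> J then f i else 0)"
    and "(\<Sum>j\<in>J. f j * (if j = i then 1 else 0)) = (if i \<in> J then f i else 0)"
  using assms by (simp_all add: if_distrib if_distribR cong: if_cong)

text \<open>The hypothesis says that the square matrix of \<open>u\<close> times its adjoint is the
  identity, and a one-sided inverse of a square matrix is two-sided. The enumeration
  \<open>e\<close> of \<open>J\<close> serves to pass to matrices indexed by numbers.\<close>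

lemma orthonormal_columns:
  assumes fin: "finite J" and on: "orthonormal J u" and j: "j \<in> J" and l: "l \<in> J"
  shows "(\<Sum>i\<in>J. cnj (u i j) * u i l) = (if j = l then 1 else 0)"
proof -
  define n where "n = card J"
  obtain e where e: "bij_betw e {0..<n} J"
    using ex_bij_betw_nat_finite[OF fin] unfolding n_def by blast
  have eJ: "e a \<in> J" if "a < n" for a using e that by (auto simp: bij_betw_def)
  have einj: "e a = e b \<longleftrightarrow> a = b" if "a < n" "b < n" for a b
    using e that by (auto simp: bij_betw_def inj_on_def)
  have reindex: "(\<Sum>k\<in>J. f k) = (\<Sum>a = 0..<n. f (e a))" for f :: "'a \<Rightarrow> complex"
    by (rule sum.reindex_bij_betw[OF e, symmetric])
  define A where "A = mat n n (\<lambda>(a,b). u (e a) (e b))"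
  define B where "B = mat n n (\<lambda>(a,b). cnj (u (e b) (e a)))"
  have A: "A \<in> carrier_mat n n" and B: "B \<in> carrier_mat n n" by (auto simp: A_def B_def)
  have "A * B = 1\<^sub>m n"
  proof (rule eq_matI)
    fix a b assume ab: "a < dim_row (1\<^sub>m n :: complex mat)" "b < dim_col (1\<^sub>m n :: complex mat)"
    then have "(A * B) $$ (a, b) = (\<Sum>c = 0..<n. u (e a) (e c) * cnj (u (e b) (e c)))"
      by (simp add: A_def B_def scalar_prod_def)
    also have "\<dots> = (\<Sum>k\<in>J. u (e a) k * cnj (u (e b) k))" by (simp add: reindex)
    also have "\<dots> = (1\<^sub>m n) $$ (a, b)"
      using on ab eJ einj by (simp add: orthonormal_def)
    finally show "(A * B) $$ (a, b) = (1\<^sub>m n) $$ (a, b)" .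
  qed (auto simp: A_def B_def)
  then have BA: "B * A = 1\<^sub>m n" by (rule mat_mult_left_right_inverse[OF A B])
  have surj: "\<exists>a<n. e a = k" if "k \<in> J" for k
    using e that by (auto simp: bij_betw_def image_iff)
  obtain a b where ab: "a < n" "e a = j" "b < n" "e b = l"
    using surj[OF j] surj[OF l] by blast
  have "(\<Sum>i\<in>J. cnj (u i j) * u i l) = (B * A) $$ (a, b)"
    using ab by (simp add: A_def B_def scalar_prod_def reindex)
  also have "\<dots> = (if j = l then 1 else 0)"
    unfolding BA using ab einj by auto
  finally show ?thesis .
qed

text \<open>The characteristic polynomial has degree \<open>card J > 0\<close>, so it has a complex
  root, which is an eigenvalue.\<close>

lemma eigenvector_exists:
  fixes M :: "'i \<Rightarrow> 'i \<Rightarrow> complex"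
  assumes fin: "finite J" and "J \<noteq> {}"
  obtains mu v where "\<exists>j\<in>J. v j \<noteq> 0" "\<And>j. j \<in> J \<Longrightarrow> (\<Sum>l\<in>J. M j l * v l) = mu * v j"
proof -
  define n where "n = card J"
  have n: "n > 0" using assms by (auto simp: n_def card_gt_0_iff)
  obtain e where e: "bij_betw e {0..<n} J"
    using ex_bij_betw_nat_finite[OF fin] unfolding n_def by blast
  have reindex: "(\<Sum>k\<in>J. f k) = (\<Sum>a = 0..<n. f (e a))" for f :: "'i \<Rightarrow> complex"
    by (rule sum.reindex_bij_betw[OF e, symmetric])
  define A where "A = mat n n (\<lambda>(a,b). M (e a) (e b))"
  have A: "A \<in> carrier_mat n n" by (simp add: A_def)
  have "degree (char_poly A) > 0" using degree_monic_char_poly[OF A] n by simp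
  then have "\<not> constant (poly (char_poly A))" by (simp add: constant_degree)
  then obtain mu where "poly (char_poly A) mu = 0" using fundamental_theorem_of_algebra by blast
  then obtain x where x: "x \<in> carrier_vec n" "x \<noteq> 0\<^sub>v n" "A *\<^sub>v x = mu \<cdot>\<^sub>v x"
    using eigenvalue_root_char_poly[OF A] A unfolding eigenvalue_def eigenvector_def by auto
  define v where "v j = x $ (the_inv_into {0..<n} e j)" for j
  have v: "v (e a) = x $ a" if "a < n" for a
    using e that unfolding v_def bij_betw_def by (simp add: the_inv_into_f_f)
  show thesis
  proof
    obtain a where "a < n" "x $ a \<noteq> 0"
      using x(1,2) by (metis carrier_vecD eq_vecI index_zero_vec)
    then have "e a \<in> J" "v (e a) \<noteq> 0" using v e by (auto simp: bij_betw_def)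
    then show "\<exists>j\<in>J. v j \<noteq> 0" by blast
    fix j assume "j \<in> J"
    then obtain a where a: "a < n" "j = e a" using e unfolding bij_betw_def by auto
    have "(\<Sum>l\<in>J. M j l * v l) = (A *\<^sub>v x) $ a"
      using a x(1) by (simp add: reindex v A_def scalar_prod_def)
    also have "\<dots> = mu * v j" unfolding x(3) using a x(1) v by simp
    finally show "(\<Sum>l\<in>J. M j l * v l) = mu * v j" .
  qed
qed

lemma complex_phase_negative: "\<exists>c::complex. cmod c = 1 \<and> c * z = - complex_of_real (cmod z)"
proof (cases "z = 0")
  case True then show ?thesis by (intro exI[of _ 1]) simp
next
  case False
  have "cnj z * z = complex_of_real (cmod z) * complex_of_real (cmod z)"
    by (simp add: complex_norm_square[symmetric] power2_eq_square mult.commute flip: of_real_mult)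
  with False show ?thesis
    by (intro exI[of _ "- (cnj z / complex_of_real (cmod z))"]) (simp add: norm_divide field_simps)
qed

text \<open>The remaining basis vectors are the images of the standard ones under the Householder
  reflection taking the \<open>i0\<close>-th standard vector to the (suitably rephased) vector \<open>v\<close>.\<close>
lemma orthonormal_completion:
  assumes fin: "finite J" and i0: "i0 \<in> J" and v: "\<exists>j\<in>J. v j \<noteq> 0"
  obtains w c where "orthonormal J w" "\<And>j. j \<in> J \<Longrightarrow> w i0 j = c * v j"
proof -
  define N where "N = sqrt (\<Sum>j\<in>J. (cmod (v j))\<^sup>2)"
  have Npos: "(\<Sum>j\<in>J. (cmod (v j))\<^sup>2) > 0"
    using v fin by (meson sum_pos2 zero_le_power2 zero_less_norm_iff zero_less_power)
  obtain c0 where c0: "cmod c0 = 1" "c0 * v i0 = - complex_of_real (cmod (v i0))"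
    using complex_phase_negative by blast
  define c where "c = c0 / complex_of_real N"
  define x where "x j = c * v j" for j
  define r where "r = cmod (v i0) / N"
  have N0: "N > 0" using Npos by (simp add: N_def)
  have r0: "r \<ge> 0" using N0 by (simp add: r_def)
  have xi0: "x i0 = - complex_of_real r" using c0 by (simp add: x_def c_def r_def)
  have "(\<Sum>j\<in>J. (cmod (x j))\<^sup>2) = (\<Sum>j\<in>J. (cmod (v j))\<^sup>2) / N\<^sup>2"
    using c0 N0 by (simp add: x_def c_def norm_mult norm_divide power_mult_distrib power_divide sum_divide_distrib)
  also have "\<dots> = 1" using Npos by (simp add: N_def)
  finally have xunit: "(\<Sum>j\<in>J. (cmod (x j))\<^sup>2) = 1" .
  then have xx: "(\<Sum>j\<in>J. x j * cnj (x j)) = 1"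
    by (simp add: complex_norm_square[symmetric] flip: of_real_sum of_real_power)
  define z where "z j = x j - (if j = i0 then 1 else 0)" for j
  have zz: "(\<Sum>j\<in>J. z j * cnj (z j)) = 2 * (1 + complex_of_real r)"
  proof -
    have "(\<Sum>j\<in>J. z j * cnj (z j)) = (\<Sum>j\<in>J. x j * cnj (x j) - x j * (if j = i0 then 1 else 0)
        - (if j = i0 then 1 else 0) * cnj (x j) + (if j = i0 then 1 else 0) * (if j = i0 then 1 else 0))"
      by (intro sum.cong) (auto simp: z_def algebra_simps)
    also have "\<dots> = 2 * (1 + complex_of_real r)"
      using fin i0 xx xi0 by (simp add: sum.distrib sum_subtractf sum_delta_mult)
    finally show ?thesis .
  qed
  define t where "t = 1 / (1 + complex_of_real r)"
  have r1: "1 + complex_of_real r \<noteq> 0"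
    using r0 by (simp add: complex_eq_iff)
  have ct: "cnj t = t" by (simp add: t_def)
  \<comment> \<open>The Householder reflection along \<open>z\<close>: by \<open>zz\<close> the
    usual factor, 2 over the squared norm of \<open>z\<close>, is \<open>t\<close>.\<close>
  define w where "w i j = (if i = j then 1 else 0) - t * z j * cnj (z i)" for i j
  show thesis
  proof
    show "orthonormal J w" unfolding orthonormal_def
    proof (intro ballI)
      fix i k assume ik: "i \<in> J" "k \<in> J"
      have "(\<Sum>j\<in>J. w i j * cnj (w k j)) = (\<Sum>j\<in>J. (if i = j then 1 else 0) * (if k = j then 1 else 0)
          - (if i = j then 1 else 0) * (t * cnj (z j) * z k) - (t * z j * cnj (z i)) * (if k = j then 1 else 0)
          + (t * t * cnj (z i) * z k) * (z j * cnj (z j)))"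
        by (intro sum.cong refl) (simp add: w_def ct algebra_simps)
      also have "\<dots> = (if i = k then 1 else 0) - t * cnj (z i) * z k - t * z k * cnj (z i)
          + (t * t * cnj (z i) * z k) * (2 * (1 + complex_of_real r))"
        using fin ik zz
        by (simp add: sum.distrib sum_subtractf sum_distrib_left[symmetric] sum_delta_mult)
      also have "\<dots> = (if i = k then 1 else 0)"
      proof -
        have "t * (1 + complex_of_real r) = 1" using r1 by (simp add: t_def)
        moreover have "(t * t * cnj (z i) * z k) * (2 * (1 + complex_of_real r))
            = 2 * (t * cnj (z i) * z k) * (t * (1 + complex_of_real r))"
          by (simp only: ac_simps)
        ultimately have "(t * t * cnj (z i) * z k) * (2 * (1 + complex_of_real r)) = 2 * (t * cnj (z i) * z k)"
          by simp
        then show ?thesis by (simp add: ac_simps)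
      qed
      finally show "(\<Sum>j\<in>J. w i j * cnj (w k j)) = (if i = k then 1 else 0)" .
    qed
    fix j assume "j \<in> J"
    have "cnj (z i0) = - (1 + complex_of_real r)" by (simp add: z_def xi0)
    then have "t * cnj (z i0) = -1" using r1 by (simp only: t_def mult_minus_right) simp
    then have "w i0 j = (if i0 = j then 1 else 0) + z j"
      unfolding w_def by (metis (no_types) diff_minus_eq_add mult.assoc mult.commute mult_minus1)
    then show "w i0 j = c * v j" by (simp add: z_def x_def)
  qed
qed

text \<open>Induction on the dimension: a unit eigenvector \<open>w i0\<close> is split off and
  \<open>M\<close> is compressed to its orthogonal complement, where the induction hypothesis
  applies. The eigenvalues are complex here; \<open>spectral_exists\<close> shows that they are
  real.\<close>

lemma eigenbasis_exists:
  assumes "finite J" "hermitian_on J M"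
  shows "\<exists>lam u. orthonormal J u \<and> (\<forall>m\<in>J. \<forall>j\<in>J. (\<Sum>l\<in>J. M j l * u m l) = lam m * u m j)"
  using assms
proof (induction "card J" arbitrary: J M)
  case 0
  then show ?case by (simp add: orthonormal_def)
next
  case (Suc n)
  then have ne: "J \<noteq> {}" by auto
  obtain mu v where v: "\<exists>j\<in>J. v j \<noteq> 0" "\<And>j. j \<in> J \<Longrightarrow> (\<Sum>l\<in>J. M j l * v l) = mu * v j"
    using eigenvector_exists[OF Suc.prems(1) ne] by metis
  obtain i0 where i0: "i0 \<in> J" using ne by auto
  obtain w c where w: "orthonormal J w" "\<And>j. j \<in> J \<Longrightarrow> w i0 j = c * v j"
    using orthonormal_completion[OF Suc.prems(1) i0 v(1)] by metis
  note fin = Suc.prems(1) and herm = Suc.prems(2)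
  define J0 where "J0 = J - {i0}"
  have fin0: "finite J0" and J: "J = insert i0 J0" and i0J0: "i0 \<notin> J0" and J0J: "J0 \<subseteq> J"
    using fin i0 by (auto simp: J0_def)
  have Mw0: "(\<Sum>l\<in>J. M j l * w i0 l) = mu * w i0 j" if "j \<in> J" for j
  proof -
    have "(\<Sum>l\<in>J. M j l * w i0 l) = c * (\<Sum>l\<in>J. M j l * v l)"
      unfolding sum_distrib_left by (intro sum.cong) (auto simp: w(2))
    with v(2)[OF that] w(2)[OF that] show ?thesis by simp
  qed
  define H where "H k i = (\<Sum>j\<in>J. cnj (w k j) * (\<Sum>l\<in>J. M j l * w i l))" for k i
  have Hherm: "H i k = cnj (H k i)" for i k
  proof -
    have "cnj (H k i) = (\<Sum>j\<in>J. \<Sum>l\<in>J. w k j * (cnj (M j l) * cnj (w i l)))"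
      by (simp add: H_def sum_distrib_left)
    also have "\<dots> = (\<Sum>j\<in>J. \<Sum>l\<in>J. cnj (w i l) * (M l j * w k j))"
      by (intro sum.cong refl) (simp add: hermitian_onD[OF herm])
    also have "\<dots> = H i k"
      unfolding H_def sum_distrib_left by (rule sum.swap)
    finally show ?thesis by simp
  qed
  \<comment> \<open>As \<open>w i0\<close> is an eigenvector orthogonal to \<open>w i\<close>, the
    coefficient \<open>H i i0\<close> vanishes, and by hermiticity so does \<open>H i0 i\<close>:
    the complement is invariant under \<open>M\<close>.\<close>
  have H0: "H i0 i = 0" if "i \<in> J0" for i
  proof -
    have "H i i0 = (\<Sum>j\<in>J. cnj (w i j) * (mu * w i0 j))"
      unfolding H_def by (intro sum.cong refl) (simp add: Mw0)
    also have "\<dots> = mu * (\<Sum>j\<in>J. w i0 j * cnj (w i j))"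
      by (simp add: sum_distrib_left algebra_simps)
    also have "(\<Sum>j\<in>J. w i0 j * cnj (w i j)) = 0"
      using w(1) that i0 i0J0 J0J unfolding orthonormal_def by (metis subsetD)
    finally show ?thesis using Hherm[of i0 i] by simp
  qed
  have expand: "(\<Sum>l\<in>J. M j l * w i l) = (\<Sum>k\<in>J0. H k i * w k j)" if "i \<in> J0" "j \<in> J" for i j
  proof -
    have "(\<Sum>k\<in>J. H k i * w k j) = (\<Sum>k\<in>J. \<Sum>j'\<in>J. (\<Sum>l\<in>J. M j' l * w i l) * (cnj (w k j') * w k j))"
      by (simp add: H_def sum_distrib_left sum_distrib_right mult.assoc mult.left_commute)
    also have "\<dots> = (\<Sum>j'\<in>J. (\<Sum>l\<in>J. M j' l * w i l) * (\<Sum>k\<in>J. cnj (w k j') * w k j))"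
      by (subst sum.swap) (simp only: sum_distrib_left)
    also have "\<dots> = (\<Sum>j'\<in>J. (\<Sum>l\<in>J. M j' l * w i l) * (if j' = j then 1 else 0))"
      by (intro sum.cong refl) (use orthonormal_columns[OF fin w(1) _ that(2)] in simp)
    also have "\<dots> = (\<Sum>l\<in>J. M j l * w i l)" by (subst sum_delta_mult(4)[OF fin]) (simp add: that)
    finally show ?thesis using fin0 i0J0 H0[OF that(1)] unfolding J by simp
  qed
  have "n = card J0" using Suc.hyps(2) fin i0 by (simp add: J0_def)
  moreover have "hermitian_on J0 H" unfolding hermitian_on_def using Hherm by blast
  ultimately have "n = card J0" "hermitian_on J0 H" by blast+
  from Suc.hyps(1)[OF this(1) fin0 this(2)] obtain lam u where
    u: "orthonormal J0 u" "\<And>m j. m \<in> J0 \<Longrightarrow> j \<in> J0 \<Longrightarrow> (\<Sum>l\<in>J0. H j l * u m l) = lam m * u m j"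
    by blast
  \<comment> \<open>The eigenvectors of the compression are coordinate vectors in the basis
    \<open>w\<close>; \<open>U\<close> writes them in the original coordinates.\<close>
  define U where "U m j = (if m = i0 then w i0 j else (\<Sum>i\<in>J0. u m i * w i j))" for m j
  define Lam where "Lam m = (if m = i0 then mu else lam m)" for m
  have won: "(\<Sum>j\<in>J. w i j * cnj (w k j)) = (if i = k then 1 else 0)" if "i \<in> J" "k \<in> J" for i k
    using w(1) that by (simp add: orthonormal_def)
  have Uw: "(\<Sum>j\<in>J. U m j * cnj (w k j)) = (if k = i0 then 0 else u m k)" if "m \<in> J0" "k \<in> J" for m k
  proof -
    have "(\<Sum>j\<in>J. U m j * cnj (w k j)) = (\<Sum>j\<in>J. \<Sum>i\<in>J0. u m i * (w i j * cnj (w k j)))"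
      using that i0J0 by (auto simp: U_def sum_distrib_right mult.assoc intro!: sum.cong)
    also have "\<dots> = (\<Sum>i\<in>J0. u m i * (\<Sum>j\<in>J. w i j * cnj (w k j)))"
      by (subst sum.swap) (simp only: sum_distrib_left)
    also have "\<dots> = (\<Sum>i\<in>J0. u m i * (if i = k then 1 else 0))"
      using that J0J by (intro sum.cong refl) (simp add: won subset_iff)
    also have "\<dots> = (if k = i0 then 0 else u m k)"
      by (subst sum_delta_mult(4)[OF fin0]) (use that i0J0 J in auto)
    finally show ?thesis .
  qed
  have UU: "(\<Sum>j\<in>J. U m j * cnj (U k j)) = (if m = k then 1 else 0)" if "m \<in> J0" "k \<in> J0" for m k
  proof -
    have "(\<Sum>j\<in>J. U m j * cnj (U k j)) = (\<Sum>j\<in>J. \<Sum>i\<in>J0. cnj (u k i) * (U m j * cnj (w i j)))"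
      using that i0J0 by (auto simp: U_def[of k] sum_distrib_left ac_simps intro!: sum.cong)
    also have "\<dots> = (\<Sum>i\<in>J0. cnj (u k i) * (\<Sum>j\<in>J. U m j * cnj (w i j)))"
      by (subst sum.swap) (simp only: sum_distrib_left)
    also have "\<dots> = (\<Sum>i\<in>J0. u m i * cnj (u k i))"
    proof (intro sum.cong refl)
      fix i assume "i \<in> J0"
      then have "i \<in> J" "i \<noteq> i0" using J0J i0J0 by auto
      with Uw[OF that(1)] show "cnj (u k i) * (\<Sum>j\<in>J. U m j * cnj (w i j)) = u m i * cnj (u k i)"
        by simp
    qed
    finally show ?thesis using u(1) that by (simp add: orthonormal_def)
  qed
  have U0: "U i0 = w i0" by (simp add: U_def fun_eq_iff)
  have "orthonormal J U" unfolding orthonormal_def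
  proof (intro ballI)
    fix m k assume mk: "m \<in> J" "k \<in> J"
    have flip: "(\<Sum>j\<in>J. w i0 j * cnj (U k j)) = cnj (\<Sum>j\<in>J. U k j * cnj (w i0 j))"
      by (simp add: mult.commute)
    show "(\<Sum>j\<in>J. U m j * cnj (U k j)) = (if m = k then 1 else 0)"
    proof (cases "m = i0")
      case True
      then show ?thesis using mk won[OF i0 i0] Uw[of k i0] i0 flip J by (cases "k = i0") (auto simp: U0)
    next
      case False
      then show ?thesis using mk Uw[of m i0] i0 J UU by (cases "k = i0") (auto simp: U0)
    qed
  qed
  moreover have "(\<Sum>l\<in>J. M j l * U m l) = Lam m * U m j" if "m \<in> J" "j \<in> J" for m j
  proof (cases "m = i0")
    case True
    then show ?thesis using Mw0 that by (simp add: U0 Lam_def)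
  next
    case False
    then have m: "m \<in> J0" using that J by auto
    have "(\<Sum>l\<in>J. M j l * U m l) = (\<Sum>l\<in>J. \<Sum>i\<in>J0. u m i * (M j l * w i l))"
      using False by (simp add: U_def sum_distrib_left ac_simps)
    also have "\<dots> = (\<Sum>i\<in>J0. u m i * (\<Sum>l\<in>J. M j l * w i l))"
      by (subst sum.swap) (simp only: sum_distrib_left)
    also have "\<dots> = (\<Sum>i\<in>J0. \<Sum>k\<in>J0. w k j * (H k i * u m i))"
      using that by (intro sum.cong refl) (simp add: expand sum_distrib_left ac_simps)
    also have "\<dots> = (\<Sum>k\<in>J0. w k j * (\<Sum>i\<in>J0. H k i * u m i))"
      by (subst sum.swap) (simp only: sum_distrib_left)
    also have "\<dots> = (\<Sum>k\<in>J0. w k j * (lam m * u m k))"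
      by (intro sum.cong refl) (simp add: u(2) m)
    also have "\<dots> = Lam m * U m j"
      using False by (simp add: Lam_def U_def sum_distrib_left ac_simps)
    finally show ?thesis .
  qed
  ultimately show ?case by blast
qed

text \<open>The eigenvalue \<open>lam m\<close> equals the quadratic form of \<open>M\<close> at
  \<open>u m\<close>, which is self-conjugate for hermitian \<open>M\<close>. The expansion of
  \<open>M\<close> follows from the completeness of the eigenbasis, in the form of
  \<open>orthonormal_columns\<close>.\<close>

lemma spectral_exists:
  assumes fin: "finite J" and herm: "hermitian_on J M"
  shows "\<exists>lam u. spectral J M lam u"
proof -
  obtain lam u where u: "orthonormal J u"
    and eig: "\<And>m j. m \<in> J \<Longrightarrow> j \<in> J \<Longrightarrow> (\<Sum>l\<in>J. M j l * u m l) = lam m * u m j"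
    using eigenbasis_exists[OF assms] by blast
  have real: "lam m = complex_of_real (Re (lam m))" if m: "m \<in> J" for m
  proof -
    have "(\<Sum>j\<in>J. cnj (u m j) * (\<Sum>l\<in>J. M j l * u m l)) = (\<Sum>j\<in>J. lam m * (u m j * cnj (u m j)))"
      using m by (intro sum.cong refl) (simp add: eig)
    also have "\<dots> = lam m * (\<Sum>j\<in>J. u m j * cnj (u m j))"
      by (simp only: sum_distrib_left)
    also have "\<dots> = lam m" using u m by (simp add: orthonormal_def)
    finally have lam: "(\<Sum>j\<in>J. cnj (u m j) * (\<Sum>l\<in>J. M j l * u m l)) = lam m" .
    have "cnj (lam m) = (\<Sum>j\<in>J. \<Sum>l\<in>J. u m j * (cnj (M j l) * cnj (u m l)))"
      unfolding lam[symmetric] by (simp add: sum_distrib_left)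
    also have "\<dots> = (\<Sum>j\<in>J. \<Sum>l\<in>J. cnj (u m l) * (M l j * u m j))"
      by (intro sum.cong refl) (simp add: hermitian_onD[OF herm])
    also have "\<dots> = lam m"
      unfolding lam[symmetric] sum_distrib_left by (rule sum.swap)
    finally show ?thesis by (simp add: complex_eq_iff)
  qed
  have "M j l = (\<Sum>i\<in>J. complex_of_real (Re (lam i)) * u i j * cnj (u i l))" if "j \<in> J" "l \<in> J" for j l
  proof -
    have "(\<Sum>i\<in>J. complex_of_real (Re (lam i)) * u i j * cnj (u i l))
        = (\<Sum>i\<in>J. \<Sum>k\<in>J. M j k * (cnj (u i l) * u i k))"
      using that by (intro sum.cong refl) (simp add: real[symmetric] eig[symmetric] sum_distrib_left sum_distrib_right ac_simps)
    also have "\<dots> = (\<Sum>k\<in>J. M j k * (\<Sum>i\<in>J. cnj (u i l) * u i k))"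
      by (subst sum.swap) (simp only: sum_distrib_left)
    also have "\<dots> = (\<Sum>k\<in>J. M j k * (if l = k then 1 else 0))"
      using that by (intro sum.cong refl) (simp add: orthonormal_columns[OF fin u])
    also have "\<dots> = M j l" by (subst sum_delta_mult(3)[OF fin]) (simp add: that)
    finally show ?thesis by simp
  qed
  then have "spectral J M (\<lambda>i. Re (lam i)) u" using u unfolding spectral_def by simp
  then show ?thesis by blast
qed

section \<open>Entropy of positive semidefinite matrices\<close>

lemma ent_term_altdef: "p \<ge> 0 \<Longrightarrow> ent_term p = - p * log 2 p"
  by (cases "p = 0") (simp_all add: ent_term_def)

lemma ent_term_mult: "a \<ge> 0 \<Longrightarrow> b \<ge> 0 \<Longrightarrow> ent_term (a * b) = a * ent_term b + b * ent_term a"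
  by (cases "a = 0"; cases "b = 0") (auto simp: ent_term_altdef log_mult algebra_simps)

text \<open>The right-hand side is the tangent at \<open>b\<close> to the concave function
  \<open>ent_term\<close>, taken at \<open>a\<close>; the inequality is
  \<open>ln t \<le> t - 1\<close> at \<open>t = b / a\<close>. Jensen's inequality and the log sum
  inequality below both come from it.\<close>

lemma ent_term_tangent:
  assumes "a \<ge> 0" "b \<ge> 0" "a > 0 \<Longrightarrow> b > 0"
  shows "ent_term a \<le> - a * log 2 b + (b - a) / ln 2"
proof (cases "a = 0")
  case True
  then show ?thesis using assms by (simp add: ent_term_def)
next
  case False
  then have a: "a > 0" and b: "b > 0" using assms by auto
  have "ln (b / a) \<le> b / a - 1" using a b by (intro ln_le_minus_one) simp
  then have "a * ln (b / a) \<le> a * (b / a - 1)" using a by (intro mult_left_mono) auto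
  then have "a * ln b - a * ln a \<le> b - a" using a b by (simp add: ln_div algebra_simps)
  then have "(a * ln b - a * ln a) / ln 2 \<le> (b - a) / ln 2" by (intro divide_right_mono) auto
  then show ?thesis using a by (simp add: ent_term_def log_def diff_divide_distrib)
qed

lemma spectral_cong:
  assumes "\<And>j l. j \<in> J \<Longrightarrow> l \<in> J \<Longrightarrow> M j l = M' j l"
  shows "spectral J M = spectral J M'"
  using assms by (simp add: spectral_def fun_eq_iff)

lemma vn_entropy_spectral:
  "vn_entropy J M = (SOME s. \<exists>lam u. spectral J M lam u \<and> s = (\<Sum>i\<in>J. ent_term (lam i)))"
  unfolding vn_entropy_def spectral_def orthonormal_def by (simp only: conj_assoc)

lemma vn_entropy_cong:
  assumes "\<And>j l. j \<in> J \<Longrightarrow> l \<in> J \<Longrightarrow> M j l = M' j l"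
  shows "vn_entropy J M = vn_entropy J M'"
  unfolding vn_entropy_spectral using spectral_cong[of J M M'] assms by simp

lemma spectral_reindex:
  assumes f: "bij_betw f J I" and s: "spectral I rho lam u"
  shows "spectral J (\<lambda>i j. rho (f i) (f j)) (\<lambda>i. lam (f i)) (\<lambda>i j. u (f i) (f j))"
proof -
  have sum: "(\<Sum>j\<in>J. h (f j)) = (\<Sum>i\<in>I. h i)" for h :: "'b \<Rightarrow> complex"
    by (rule sum.reindex_bij_betw[OF f])
  have fI: "f j \<in> I" if "j \<in> J" for j using f that by (auto simp: bij_betw_def)
  have inj: "f i = f j \<longleftrightarrow> i = j" if "i \<in> J" "j \<in> J" for i j
    using f that by (auto simp: bij_betw_def inj_on_def)
  show ?thesis
    using s fI unfolding spectral_def orthonormal_def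
    by (simp add: sum[of "\<lambda>j. u _ j * cnj (u _ j)"]
        sum[of "\<lambda>i. complex_of_real (lam i) * u i _ * cnj (u i _)"] inj)
qed

text \<open>Decompositions are carried along \<open>f\<close> and along its inverse, so both sides
  choose from the same set of candidate values.\<close>

lemma vn_entropy_reindex:
  assumes f: "bij_betw f J I"
  shows "vn_entropy I rho = vn_entropy J (\<lambda>i j. rho (f i) (f j))"
proof -
  define g where "g = the_inv_into J f"
  have g: "bij_betw g I J" unfolding g_def by (rule bij_betw_the_inv_into[OF f])
  have fg: "f (g i) = i" if "i \<in> I" for i
    using f that unfolding g_def bij_betw_def by (auto intro: f_the_inv_into_f)
  have "(\<exists>lam u. spectral I rho lam u \<and> s = (\<Sum>i\<in>I. ent_term (lam i))) \<longleftrightarrow>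
        (\<exists>lam u. spectral J (\<lambda>i j. rho (f i) (f j)) lam u \<and> s = (\<Sum>i\<in>J. ent_term (lam i)))" (is "?L \<longleftrightarrow> ?R") for s
  proof
    assume ?L
    then obtain lam u where "spectral I rho lam u" and s: "s = (\<Sum>i\<in>I. ent_term (lam i))" by blast
    from spectral_reindex[OF f this(1)] sum.reindex_bij_betw[OF f, of "\<lambda>i. ent_term (lam i)"] s
    show ?R by (intro exI[of _ "\<lambda>i. lam (f i)"] exI[of _ "\<lambda>i j. u (f i) (f j)"]) simp
  next
    assume ?R
    then obtain lam u where "spectral J (\<lambda>i j. rho (f i) (f j)) lam u"
      and s: "s = (\<Sum>i\<in>J. ent_term (lam i))" by blast
    from spectral_reindex[OF g this(1)]
    have "spectral I rho (\<lambda>i. lam (g i)) (\<lambda>i j. u (g i) (g j))"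
      using spectral_cong[of I "\<lambda>i j. rho (f (g i)) (f (g j))" rho] fg by simp
    with sum.reindex_bij_betw[OF g, of "\<lambda>i. ent_term (lam i)"] s
    show ?L by (intro exI[of _ "\<lambda>i. lam (g i)"] exI[of _ "\<lambda>i j. u (g i) (g j)"]) simp
  qed
  then show ?thesis unfolding vn_entropy_spectral by simp
qed

section \<open>Quadratic forms and positive semidefinite matrices\<close>

lemma qform_rank_one_sum:
  assumes "\<And>j l. j \<in> J \<Longrightarrow> l \<in> J \<Longrightarrow> M j l = (\<Sum>i\<in>K. complex_of_real (lam i) * T i j * cnj (T i l))"
  shows "qform J M w = complex_of_real (\<Sum>i\<in>K. lam i * (cmod (\<Sum>l\<in>J. cnj (T i l) * w l))\<^sup>2)"
proof -
  have "qform J M w = (\<Sum>j\<in>J. \<Sum>l\<in>J. \<Sum>i\<in>K. complex_of_real (lam i) * ((cnj (w j) * T i j) * (cnj (T i l) * w l)))"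
    unfolding qform_def using assms
    by (intro sum.cong refl) (simp add: sum_distrib_left sum_distrib_right ac_simps)
  also have "\<dots> = (\<Sum>j\<in>J. \<Sum>i\<in>K. \<Sum>l\<in>J. complex_of_real (lam i) * ((cnj (w j) * T i j) * (cnj (T i l) * w l)))"
    by (intro sum.cong refl sum.swap)
  also have "\<dots> = (\<Sum>i\<in>K. \<Sum>j\<in>J. \<Sum>l\<in>J. complex_of_real (lam i) * ((cnj (w j) * T i j) * (cnj (T i l) * w l)))"
    by (rule sum.swap)
  also have "\<dots> = (\<Sum>i\<in>K. complex_of_real (lam i) * ((\<Sum>j\<in>J. cnj (w j) * T i j) * (\<Sum>l\<in>J. cnj (T i l) * w l)))"
    by (intro sum.cong refl) (simp only: sum_product, simp only: sum_distrib_left)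
  also have "\<dots> = (\<Sum>i\<in>K. complex_of_real (lam i) * complex_of_real ((cmod (\<Sum>l\<in>J. cnj (T i l) * w l))\<^sup>2))"
  proof (intro sum.cong refl)
    fix i
    have "(\<Sum>j\<in>J. cnj (w j) * T i j) = cnj (\<Sum>l\<in>J. cnj (T i l) * w l)" by (simp add: mult.commute)
    then show "complex_of_real (lam i) * ((\<Sum>j\<in>J. cnj (w j) * T i j) * (\<Sum>l\<in>J. cnj (T i l) * w l))
      = complex_of_real (lam i) * complex_of_real ((cmod (\<Sum>l\<in>J. cnj (T i l) * w l))\<^sup>2)"
      by (simp only: complex_norm_square mult.commute)
  qed
  finally show ?thesis by simp
qed

lemma psd_rank_one_sum:
  assumes M: "\<And>j l. j \<in> J \<Longrightarrow> l \<in> J \<Longrightarrow> M j l = (\<Sum>i\<in>K. complex_of_real (lam i) * T i j * cnj (T i l))"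
    and lam: "\<And>i. i \<in> K \<Longrightarrow> lam i \<ge> 0"
  shows "psd J M"
  unfolding psd_def
proof (intro conjI allI)
  show "hermitian_on J M" unfolding hermitian_on_def by (simp add: M ac_simps)
  show "Re (qform J M w) \<ge> 0" for w
    using qform_rank_one_sum[where J = J and M = M and K = K and lam = lam and T = T and w = w] M lam by (simp add: sum_nonneg)
qed

lemma psd_gram: "psd J (\<lambda>j l. \<Sum>k\<in>K. T j k * cnj (T l k))"
  by (rule psd_rank_one_sum[where K = K and lam = "\<lambda>_. 1" and T = "\<lambda>k j. T j k"]) simp_all

lemma qform_sum: "qform J (\<lambda>j l. \<Sum>x\<in>X. M x j l) w = (\<Sum>x\<in>X. qform J (M x) w)"
proof -
  have "qform J (\<lambda>j l. \<Sum>x\<in>X. M x j l) w = (\<Sum>j\<in>J. \<Sum>l\<in>J. \<Sum>x\<in>X. cnj (w j) * M x j l * w l)"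
    by (simp add: qform_def sum_distrib_left sum_distrib_right)
  also have "\<dots> = (\<Sum>j\<in>J. \<Sum>x\<in>X. \<Sum>l\<in>J. cnj (w j) * M x j l * w l)"
    by (intro sum.cong refl sum.swap)
  also have "\<dots> = (\<Sum>x\<in>X. qform J (M x) w)"
    unfolding qform_def by (rule sum.swap)
  finally show ?thesis .
qed

lemma psd_sum:
  assumes "\<And>x. x \<in> X \<Longrightarrow> psd J (M x)"
  shows "psd J (\<lambda>j l. \<Sum>x\<in>X. M x j l)"
  unfolding psd_def
proof (intro conjI allI)
  show "hermitian_on J (\<lambda>j l. \<Sum>x\<in>X. M x j l)"
    unfolding hermitian_on_def
  proof (intro ballI)
    fix j l assume "j \<in> J" "l \<in> J"
    then have "M x l j = cnj (M x j l)" if "x \<in> X" for x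
      using assms[OF that] hermitian_onD[of J "M x" j l] unfolding psd_def by simp
    then show "(\<Sum>x\<in>X. M x l j) = cnj (\<Sum>x\<in>X. M x j l)"
      unfolding cnj_sum by (rule sum.cong[OF refl])
  qed
  show "Re (qform J (\<lambda>j l. \<Sum>x\<in>X. M x j l) w) \<ge> 0" for w
    using assms by (simp add: qform_sum psd_def sum_nonneg)
qed

text \<open>The resolution of the identity given by \<open>u\<close> is evaluated as a quadratic
  form in two ways.\<close>

lemma parseval:
  assumes fin: "finite J" and on: "orthonormal J u"
  shows "(\<Sum>i\<in>J. (cmod (\<Sum>l\<in>J. cnj (u i l) * x l))\<^sup>2) = (\<Sum>l\<in>J. (cmod (x l))\<^sup>2)"
proof -
  define I where "I j l = (\<Sum>i\<in>J. complex_of_real 1 * u i j * cnj (u i l))" for j l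
  have "I j l = (if j = l then 1 else 0)" if "j \<in> J" "l \<in> J" for j l
    using orthonormal_columns[OF fin on that(2,1)] by (auto simp: I_def mult.commute)
  then have "qform J I x = (\<Sum>j\<in>J. \<Sum>l\<in>J. (cnj (x j) * x l) * (if j = l then 1 else 0))"
    unfolding qform_def by (intro sum.cong refl) simp
  also have "\<dots> = (\<Sum>j\<in>J. cnj (x j) * x j)"
    by (intro sum.cong refl) (simp only: sum_delta_mult(3)[OF fin] if_True)
  also have "\<dots> = complex_of_real (\<Sum>l\<in>J. (cmod (x l))\<^sup>2)"
    by (simp only: complex_norm_square of_real_sum mult.commute)
  finally have "qform J I x = complex_of_real (\<Sum>l\<in>J. (cmod (x l))\<^sup>2)" .
  moreover have "qform J I x = complex_of_real (\<Sum>i\<in>J. 1 * (cmod (\<Sum>l\<in>J. cnj (u i l) * x l))\<^sup>2)"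
    by (rule qform_rank_one_sum) (simp only: I_def)
  ultimately show ?thesis by (simp only: of_real_eq_iff mult_1)
qed

lemma orthonormal_norm:
  assumes "orthonormal J u" "i \<in> J"
  shows "(\<Sum>l\<in>J. (cmod (u i l))\<^sup>2) = 1"
proof -
  have "complex_of_real (\<Sum>l\<in>J. (cmod (u i l))\<^sup>2) = 1"
    using assms unfolding of_real_sum complex_norm_square orthonormal_def by simp
  then show ?thesis by (simp only: of_real_eq_1_iff)
qed

lemma spectral_eigenvector:
  assumes fin: "finite J" and s: "spectral J M lam u" and i: "i \<in> J" and j: "j \<in> J"
  shows "(\<Sum>l\<in>J. M j l * u i l) = complex_of_real (lam i) * u i j"
proof -
  have "(\<Sum>l\<in>J. M j l * u i l) = (\<Sum>l\<in>J. \<Sum>m\<in>J. (complex_of_real (lam m) * u m j) * (u i l * cnj (u m l)))"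
    using s j unfolding spectral_def
    by (intro sum.cong refl) (simp add: sum_distrib_right sum_distrib_left ac_simps)
  also have "\<dots> = (\<Sum>m\<in>J. (complex_of_real (lam m) * u m j) * (\<Sum>l\<in>J. u i l * cnj (u m l)))"
    by (subst sum.swap) (simp only: sum_distrib_left)
  also have "\<dots> = (\<Sum>m\<in>J. (complex_of_real (lam m) * u m j) * (if i = m then 1 else 0))"
    using s i unfolding spectral_def orthonormal_def by (intro sum.cong refl) simp
  also have "\<dots> = complex_of_real (lam i) * u i j"
    by (subst sum_delta_mult(3)[OF fin]) (simp add: i)
  finally show ?thesis .
qed

lemma qform_spectral:
  assumes "spectral J M lam u"
  shows "Re (qform J M w) = (\<Sum>i\<in>J. lam i * (cmod (\<Sum>l\<in>J. cnj (u i l) * w l))\<^sup>2)"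
  using qform_rank_one_sum[where J = J and M = M and K = J and lam = lam and T = u and w = w] assms by (simp add: spectral_def)

lemma qform_eigenvector:
  assumes fin: "finite J" and s: "spectral J M lam u" and i: "i \<in> J"
  shows "Re (qform J M (u i)) = lam i"
proof -
  have "(\<Sum>l\<in>J. cnj (u k l) * u i l) = (if i = k then 1 else 0)" if "k \<in> J" for k
    using s i that unfolding spectral_def orthonormal_def by (simp add: mult.commute)
  then have "Re (qform J M (u i)) = (\<Sum>k\<in>J. lam k * (if i = k then 1 else 0))"
    unfolding qform_spectral[OF s] by (intro sum.cong refl) simp
  also have "\<dots> = lam i" by (subst sum_delta_mult(3)[OF fin]) (simp add: i)
  finally show ?thesis .
qed

lemma spectral_nonneg:
  "finite J \<Longrightarrow> psd J M \<Longrightarrow> spectral J M lam u \<Longrightarrow> i \<in> J \<Longrightarrow> lam i \<ge> 0"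
  using qform_eigenvector[of J M lam u i] by (metis psd_def)

lemma spectral_psd:
  assumes "spectral J M lam u" "\<And>i. i \<in> J \<Longrightarrow> lam i \<ge> 0"
  shows "psd J M"
  using psd_rank_one_sum[where J = J and M = M and K = J and lam = lam and T = u] assms by (simp add: spectral_def)

text \<open>Jensen's inequality for the doubly stochastic matrix of squared overlaps. Applied to two
  eigenbases, it shows that the choice in \<open>vn_entropy\<close> is irrelevant.\<close>
lemma spectral_entropy_le:
  assumes fin: "finite J" and p: "psd J M" and s: "spectral J M lam u" and w: "orthonormal J w"
  shows "(\<Sum>i\<in>J. ent_term (lam i)) \<le> (\<Sum>k\<in>J. ent_term (Re (qform J M (w k))))"
proof -
  have u: "orthonormal J u" using s by (simp add: spectral_def)
  define d where "d i k = (cmod (\<Sum>l\<in>J. cnj (u i l) * w k l))\<^sup>2" for i k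
  have d0: "d i k \<ge> 0" for i k by (simp add: d_def)
  have lam0: "lam i \<ge> 0" if "i \<in> J" for i using spectral_nonneg[OF fin p s that] .
  have dcol: "(\<Sum>i\<in>J. d i k) = 1" if "k \<in> J" for k
    unfolding d_def using parseval[OF fin u] orthonormal_norm[OF w that] by simp
  have drow: "(\<Sum>k\<in>J. d i k) = 1" if "i \<in> J" for i
  proof -
    have "d i k = (cmod (\<Sum>l\<in>J. cnj (w k l) * u i l))\<^sup>2" for k
    proof -
      have "(\<Sum>l\<in>J. cnj (u i l) * w k l) = cnj (\<Sum>l\<in>J. cnj (w k l) * u i l)" by (simp add: mult.commute)
      then show ?thesis by (simp only: d_def complex_mod_cnj)
    qed
    then show ?thesis using parseval[OF fin w, of "u i"] orthonormal_norm[OF u that] by simp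
  qed
  define t where "t k = Re (qform J M (w k))" for k
  have t: "t k = (\<Sum>i\<in>J. lam i * d i k)" for k unfolding t_def d_def by (rule qform_spectral[OF s])
  have t0: "t k \<ge> 0" for k unfolding t using lam0 d0 by (simp add: sum_nonneg)
  have jensen: "(\<Sum>i\<in>J. d i k * ent_term (lam i)) \<le> ent_term (t k)" if k: "k \<in> J" for k
  proof -
    have "(\<Sum>i\<in>J. d i k * ent_term (lam i)) \<le> (\<Sum>i\<in>J. d i k * (- lam i * log 2 (t k) + (t k - lam i) / ln 2))"
    proof (intro sum_mono)
      fix i assume i: "i \<in> J"
      show "d i k * ent_term (lam i) \<le> d i k * (- lam i * log 2 (t k) + (t k - lam i) / ln 2)"
      proof (cases "d i k = 0")
        case False
        have "t k > 0" if "lam i > 0"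
        proof -
          have "0 < lam i * d i k" using that False d0[of i k] by simp
          then show ?thesis unfolding t using fin i lam0 d0 by (intro sum_pos2[of J i]) auto
        qed
        then show ?thesis using d0 lam0[OF i] t0 by (intro mult_left_mono ent_term_tangent) auto
      qed simp
    qed
    \<comment> \<open>Since \<open>t k\<close> is the mean of the \<open>lam i\<close> with weights
      \<open>d i k\<close>, the linear terms of the tangent bound add up to zero.\<close>
    also have "\<dots> = (\<Sum>i\<in>J. (lam i * d i k) * (- log 2 (t k) - 1 / ln 2) + d i k * (t k / ln 2))"
      by (intro sum.cong refl) (simp add: algebra_simps diff_divide_distrib)
    also have "\<dots> = t k * (- log 2 (t k) - 1 / ln 2) + t k / ln 2"
      by (simp only: sum.distrib sum_distrib_right[symmetric] t[symmetric] dcol[OF k] mult_1)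
    also have "\<dots> = ent_term (t k)" using t0[of k] by (simp add: ent_term_altdef algebra_simps)
    finally show ?thesis .
  qed
  have "(\<Sum>i\<in>J. ent_term (lam i)) = (\<Sum>i\<in>J. \<Sum>k\<in>J. d i k * ent_term (lam i))"
    by (intro sum.cong refl) (simp add: sum_distrib_right[symmetric] drow)
  also have "\<dots> = (\<Sum>k\<in>J. \<Sum>i\<in>J. d i k * ent_term (lam i))" by (rule sum.swap)
  also have "\<dots> \<le> (\<Sum>k\<in>J. ent_term (t k))" by (intro sum_mono jensen)
  finally show ?thesis unfolding t_def .
qed

text \<open>At the vectors of a second eigenbasis the quadratic form takes the second list of
  eigenvalues, so the two entropies bound each other.\<close>

lemma vn_entropy_eq:
  assumes fin: "finite J" and p: "psd J M" and s: "spectral J M lam u"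
  shows "vn_entropy J M = (\<Sum>i\<in>J. ent_term (lam i))"
proof -
  have "(\<Sum>i\<in>J. ent_term (lam i)) \<le> (\<Sum>i\<in>J. ent_term (lam' i))"
    if "spectral J M lam u" "spectral J M lam' u'" for lam u lam' u'
  proof -
    have "orthonormal J u'" using that by (simp add: spectral_def)
    from spectral_entropy_le[OF fin p that(1) this] show ?thesis
      by (simp add: qform_eigenvector[OF fin that(2)])
  qed
  then have "(\<Sum>i\<in>J. ent_term (lam' i)) = (\<Sum>i\<in>J. ent_term (lam i))" if "spectral J M lam' u'" for lam' u'
    using that s by (meson antisym)
  then show ?thesis unfolding vn_entropy_spectral using s
    by (intro some_equality) blast+
qed

lemma psd_spectral_obtain:
  assumes "finite J" "psd J M"
  obtains lam u where "spectral J M lam u" "\<And>i. i \<in> J \<Longrightarrow> lam i \<ge> 0"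
    "vn_entropy J M = (\<Sum>i\<in>J. ent_term (lam i))"
proof -
  obtain lam u where s: "spectral J M lam u"
    using spectral_exists[of J M] assms unfolding psd_def by blast
  show thesis
    by (rule that[OF s spectral_nonneg[OF assms s] vn_entropy_eq[OF assms s]])
qed

text \<open>In physical terms, a projective measurement cannot lower the entropy.\<close>

lemma vn_entropy_le_basis:
  assumes "finite J" "psd J M" "orthonormal J w"
  shows "vn_entropy J M \<le> (\<Sum>k\<in>J. ent_term (Re (qform J M (w k))))"
proof -
  obtain lam u where "spectral J M lam u" "vn_entropy J M = (\<Sum>i\<in>J. ent_term (lam i))"
    using psd_spectral_obtain[OF assms(1,2)] by blast
  with spectral_entropy_le[OF assms(1,2) _ assms(3)] show ?thesis by simp
qed

lemma trace_qform:
  assumes fin: "finite J" and w: "orthonormal J w"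
  shows "(\<Sum>k\<in>J. qform J M (w k)) = (\<Sum>j\<in>J. M j j)"
proof -
  have "(\<Sum>k\<in>J. qform J M (w k)) = (\<Sum>k\<in>J. \<Sum>j\<in>J. \<Sum>l\<in>J. M j l * (cnj (w k j) * w k l))"
    by (simp add: qform_def ac_simps)
  also have "\<dots> = (\<Sum>j\<in>J. \<Sum>k\<in>J. \<Sum>l\<in>J. M j l * (cnj (w k j) * w k l))" by (rule sum.swap)
  also have "\<dots> = (\<Sum>j\<in>J. \<Sum>l\<in>J. \<Sum>k\<in>J. M j l * (cnj (w k j) * w k l))" by (intro sum.cong refl sum.swap)
  also have "\<dots> = (\<Sum>j\<in>J. \<Sum>l\<in>J. M j l * (if j = l then 1 else 0))"
    by (intro sum.cong refl) (simp only: sum_distrib_left[symmetric] orthonormal_columns[OF fin w])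
  also have "\<dots> = (\<Sum>j\<in>J. M j j)"
    by (intro sum.cong refl) (simp only: sum_delta_mult(3)[OF fin] if_True)
  finally show ?thesis .
qed

text \<open>The eigenbases of the blocks, extended by zero, together form an eigenbasis of the
  whole. The bijection \<open>f\<close> absorbs the dummy coordinates that traced-out registers
  leave in \<open>red_idx\<close>.\<close>

lemma vn_entropy_blocks:
  fixes M :: "'k \<Rightarrow> 'j \<Rightarrow> 'j \<Rightarrow> complex" and f :: "'k \<times> 'j \<Rightarrow> 'i"
  assumes K: "finite K" and J: "finite J" and f: "bij_betw f (K \<times> J) I"
    and M: "\<And>k. k \<in> K \<Longrightarrow> psd J (M k)"
    and rho: "\<And>k j k' j'. k \<in> K \<Longrightarrow> j \<in> J \<Longrightarrow> k' \<in> K \<Longrightarrow> j' \<in> J \<Longrightarrow>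
      rho (f (k, j)) (f (k', j')) = (if k = k' then M k j j' else 0)"
  shows "vn_entropy I rho = (\<Sum>k\<in>K. vn_entropy J (M k))"
proof -
  have "\<exists>lam u. spectral J (M k) lam u \<and> (\<forall>i\<in>J. lam i \<ge> 0) \<and>
      vn_entropy J (M k) = (\<Sum>i\<in>J. ent_term (lam i))" if "k \<in> K" for k
    using psd_spectral_obtain[OF J M[OF that]] by metis
  then obtain lam u where lu: "\<And>k. k \<in> K \<Longrightarrow> spectral J (M k) (lam k) (u k)"
    "\<And>k i. k \<in> K \<Longrightarrow> i \<in> J \<Longrightarrow> lam k i \<ge> 0"
    "\<And>k. k \<in> K \<Longrightarrow> vn_entropy J (M k) = (\<Sum>i\<in>J. ent_term (lam k i))"
    by metis
  define R where "R p q = rho (f p) (f q)" for p q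
  define L where "L p = (case p of (k, i) \<Rightarrow> lam k i)" for p
  define U where "U p q = (case p of (k, i) \<Rightarrow> case q of (k', j) \<Rightarrow> if k = k' then u k i j else 0)" for p q
  have delta: "(\<Sum>q\<in>K. if k = q then h q else 0) = h k" if "k \<in> K" for h :: "'k \<Rightarrow> complex" and k
    using that K by simp
  have sumK: "(\<Sum>p\<in>K \<times> J. h p) = (\<Sum>k\<in>K. \<Sum>j\<in>J. h (k, j))" for h :: "'k \<times> 'j \<Rightarrow> complex"
    by (simp add: sum.cartesian_product)
  have "spectral (K \<times> J) R L U"
    unfolding spectral_def orthonormal_def
  proof (intro conjI ballI)
    fix p q assume pq: "p \<in> K \<times> J" "q \<in> K \<times> J"
    obtain k i k' j where [simp]: "p = (k, i)" "q = (k', j)" by fastforce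
    have m: "k \<in> K" "i \<in> J" "k' \<in> K" "j \<in> J" using pq by auto
    have "(\<Sum>x\<in>K \<times> J. U p x * cnj (U q x)) = (\<Sum>x\<in>K. if k = x then (\<Sum>l\<in>J. u k i l * cnj (U q (x, l))) else 0)"
      unfolding sumK by (intro sum.cong refl) (auto simp: U_def)
    also have "\<dots> = (\<Sum>l\<in>J. u k i l * cnj (U q (k, l)))" by (rule delta[OF m(1)])
    also have "\<dots> = (if p = q then 1 else 0)"
      using lu(1)[OF m(1)] m by (cases "k = k'") (auto simp: U_def spectral_def orthonormal_def)
    finally show "(\<Sum>x\<in>K \<times> J. U p x * cnj (U q x)) = (if p = q then 1 else 0)" .
    have "(\<Sum>x\<in>K \<times> J. complex_of_real (L x) * U x p * cnj (U x q))
        = (\<Sum>x\<in>K. if k = x then (\<Sum>l\<in>J. complex_of_real (lam x l) * u x l i * cnj (U (x, l) q)) else 0)"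
      unfolding sumK by (intro sum.cong refl) (auto simp: U_def L_def)
    also have "\<dots> = (\<Sum>l\<in>J. complex_of_real (lam k l) * u k l i * cnj (U (k, l) q))" by (rule delta[OF m(1)])
    also have "\<dots> = R p q"
      using lu(1)[OF m(1)] m by (cases "k = k'") (auto simp: U_def R_def rho spectral_def)
    finally show "R p q = (\<Sum>x\<in>K \<times> J. complex_of_real (L x) * U x p * cnj (U x q))" by simp
  qed
  moreover have "finite (K \<times> J)" using K J by simp
  moreover have "L p \<ge> 0" if "p \<in> K \<times> J" for p using that lu(2) by (auto simp: L_def)
  ultimately have "vn_entropy (K \<times> J) R = (\<Sum>p\<in>K \<times> J. ent_term (L p))"
    using vn_entropy_eq spectral_psd by blast
  also have "\<dots> = (\<Sum>k\<in>K. \<Sum>i\<in>J. ent_term (lam k i))"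
    by (simp add: L_def sum.cartesian_product case_prod_beta)
  also have "\<dots> = (\<Sum>k\<in>K. vn_entropy J (M k))" by (simp add: lu(3))
  finally show ?thesis unfolding R_def using vn_entropy_reindex[OF f, of rho] by simp
qed

section \<open>Superadditivity of the excess entropy\<close>

text \<open>For a matrix of trace \<open>p\<close> this is \<open>p\<close> times the entropy of the normalised matrix.\<close>
definition excess :: "'i set \<Rightarrow> ('i \<Rightarrow> 'i \<Rightarrow> complex) \<Rightarrow> real" where
  "excess J M = vn_entropy J M - ent_term (\<Sum>j\<in>J. Re (M j j))"

lemma excess_cong:
  assumes "\<And>j l. j \<in> J \<Longrightarrow> l \<in> J \<Longrightarrow> M j l = M' j l"
  shows "excess J M = excess J M'"
  unfolding excess_def using vn_entropy_cong[of J M M'] assms by simp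

lemma trace_qform_Re:
  assumes "finite J" "orthonormal J w"
  shows "(\<Sum>j\<in>J. Re (M j j)) = (\<Sum>k\<in>J. Re (qform J M (w k)))"
  using arg_cong[OF trace_qform[OF assms, of M], of Re] by simp

lemma trace_spectral:
  assumes fin: "finite J" and s: "spectral J M lam u"
  shows "(\<Sum>j\<in>J. Re (M j j)) = (\<Sum>i\<in>J. lam i)"
proof -
  have "orthonormal J u" using s by (simp add: spectral_def)
  from trace_qform_Re[OF fin this, of M] show ?thesis by (simp add: qform_eigenvector[OF fin s])
qed

text \<open>After normalisation this is the nonnegativity of the mutual information of the table
  \<open>d\<close>. The tangent bound compares each entry with the product
  \<open>t x * e i / D\<close> of its row and column sums.\<close>

lemma log_sum_inequality:
  fixes d :: "'x \<Rightarrow> 'i \<Rightarrow> real"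
  assumes finX: "finite X" and finJ: "finite J" and d0: "\<And>x i. x \<in> X \<Longrightarrow> i \<in> J \<Longrightarrow> d x i \<ge> 0"
  shows "(\<Sum>x\<in>X. (\<Sum>i\<in>J. ent_term (d x i)) - ent_term (\<Sum>i\<in>J. d x i))
    \<le> (\<Sum>i\<in>J. ent_term (\<Sum>x\<in>X. d x i)) - ent_term (\<Sum>x\<in>X. \<Sum>i\<in>J. d x i)"
proof -
  define t where "t x = (\<Sum>i\<in>J. d x i)" for x
  define e where "e i = (\<Sum>x\<in>X. d x i)" for i
  define D where "D = (\<Sum>x\<in>X. t x)"
  have De: "D = (\<Sum>i\<in>J. e i)" unfolding D_def t_def e_def by (rule sum.swap)
  have t0: "t x \<ge> 0" if "x \<in> X" for x using that d0 by (simp add: t_def sum_nonneg)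
  have e0: "e i \<ge> 0" if "i \<in> J" for i using that d0 by (simp add: e_def sum_nonneg)
  have D0: "D \<ge> 0" using t0 by (simp add: D_def sum_nonneg)
  have pointwise: "ent_term (d x i) \<le> - d x i * log 2 (t x) - d x i * log 2 (e i) + d x i * log 2 D
      + (t x * e i / D - d x i) / ln 2" if x: "x \<in> X" and i: "i \<in> J" for x i
  proof -
    have pos: "t x > 0 \<and> e i > 0 \<and> D > 0" if "d x i > 0"
    proof -
      have "t x > 0" unfolding t_def using finJ i that d0[OF x] by (intro sum_pos2[of J i]) auto
      moreover have "e i > 0" unfolding e_def using finX x that d0 i by (intro sum_pos2[of X x]) auto
      moreover have "D > 0" unfolding D_def using finX x \<open>t x > 0\<close> t0 by (intro sum_pos2[of X x]) auto
      ultimately show ?thesis by blast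
    qed
    have "ent_term (d x i) \<le> - d x i * log 2 (t x * e i / D) + (t x * e i / D - d x i) / ln 2"
      using d0[OF x i] t0[OF x] e0[OF i] D0 pos by (intro ent_term_tangent) auto
    also have "- d x i * log 2 (t x * e i / D) = - d x i * log 2 (t x) - d x i * log 2 (e i) + d x i * log 2 D"
    proof (cases "d x i = 0")
      case False
      then have "t x > 0" "e i > 0" "D > 0" using pos d0[OF x i] by auto
      then show ?thesis by (simp add: log_mult log_divide algebra_simps)
    qed simp
    finally show ?thesis .
  qed
  \<comment> \<open>The products and the entries of the table have the same total \<open>D\<close>,
    so the linear terms cancel.\<close>
  have rest: "(\<Sum>x\<in>X. \<Sum>i\<in>J. (t x * e i / D - d x i) / ln 2) = 0"
  proof -
    have "(\<Sum>x\<in>X. \<Sum>i\<in>J. (t x * e i / D - d x i) / ln 2)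
        = ((\<Sum>x\<in>X. \<Sum>i\<in>J. t x * e i) / D - (\<Sum>x\<in>X. \<Sum>i\<in>J. d x i)) / ln 2"
      by (simp add: sum_divide_distrib sum_subtractf diff_divide_distrib)
    also have "(\<Sum>x\<in>X. \<Sum>i\<in>J. t x * e i) = D * D"
      unfolding sum_product[symmetric] by (simp add: D_def[symmetric] De[symmetric])
    also have "(\<Sum>x\<in>X. \<Sum>i\<in>J. d x i) = D" by (simp add: D_def t_def)
    finally show ?thesis by simp
  qed
  have "(\<Sum>x\<in>X. \<Sum>i\<in>J. ent_term (d x i)) \<le> (\<Sum>x\<in>X. \<Sum>i\<in>J. - d x i * log 2 (t x) - d x i * log 2 (e i)
      + d x i * log 2 D + (t x * e i / D - d x i) / ln 2)"
    by (intro sum_mono pointwise)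
  also have "\<dots> = - (\<Sum>x\<in>X. \<Sum>i\<in>J. d x i * log 2 (t x)) - (\<Sum>x\<in>X. \<Sum>i\<in>J. d x i * log 2 (e i))
      + (\<Sum>x\<in>X. \<Sum>i\<in>J. d x i * log 2 D)"
    by (simp add: sum.distrib sum_subtractf sum_negf rest)
  also have "(\<Sum>x\<in>X. \<Sum>i\<in>J. d x i * log 2 (t x)) = - (\<Sum>x\<in>X. ent_term (t x))"
    by (simp add: sum_distrib_right[symmetric] t_def[symmetric] t0 ent_term_altdef sum_negf)
  also have "(\<Sum>x\<in>X. \<Sum>i\<in>J. d x i * log 2 (e i)) = - (\<Sum>i\<in>J. ent_term (e i))"
    by (subst sum.swap) (simp add: sum_distrib_right[symmetric] e_def[symmetric] e0 ent_term_altdef sum_negf)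
  also have "(\<Sum>x\<in>X. \<Sum>i\<in>J. d x i * log 2 D) = - ent_term D"
    by (simp add: sum_distrib_right[symmetric] t_def[symmetric] D_def[symmetric] D0 ent_term_altdef)
  finally show ?thesis
    unfolding D_def[symmetric] t_def[symmetric] e_def[symmetric] by (simp add: sum_subtractf)
qed

text \<open>This is concavity of the von Neumann entropy for unnormalised states. All summands are
  measured in the eigenbasis of the sum: this keeps the entropy of the sum and all traces and can
  only raise the entropies of the summands, so that the classical \<open>log_sum_inequality\<close>
  remains.\<close>

lemma excess_superadditive:
  assumes finJ: "finite J" and finX: "finite X" and p: "\<And>x. x \<in> X \<Longrightarrow> psd J (M x)"
  shows "(\<Sum>x\<in>X. excess J (M x)) \<le> excess J (\<lambda>j l. \<Sum>x\<in>X. M x j l)"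
proof -
  let ?S = "\<lambda>j l. \<Sum>x\<in>X. M x j l"
  obtain lam u where s: "spectral J ?S lam u" and vn: "vn_entropy J ?S = (\<Sum>i\<in>J. ent_term (lam i))"
    using psd_spectral_obtain[OF finJ psd_sum[of X J M, OF p]] by blast
  have u: "orthonormal J u" using s by (simp add: spectral_def)
  define d where "d x i = Re (qform J (M x) (u i))" for x i
  have d0: "d x i \<ge> 0" if "x \<in> X" for x i using p[OF that] by (simp add: d_def psd_def)
  have lam: "lam i = (\<Sum>x\<in>X. d x i)" if "i \<in> J" for i
    using qform_eigenvector[OF finJ s that] by (simp add: qform_sum d_def)
  have "(\<Sum>x\<in>X. excess J (M x)) \<le> (\<Sum>x\<in>X. (\<Sum>i\<in>J. ent_term (d x i)) - ent_term (\<Sum>i\<in>J. d x i))"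
    unfolding excess_def trace_qform_Re[OF finJ u] d_def
    using vn_entropy_le_basis[OF finJ p u] by (intro sum_mono) simp
  also have "\<dots> \<le> (\<Sum>i\<in>J. ent_term (\<Sum>x\<in>X. d x i)) - ent_term (\<Sum>x\<in>X. \<Sum>i\<in>J. d x i)"
    by (rule log_sum_inequality[OF finX finJ d0])
  also have "\<dots> = excess J ?S"
    unfolding excess_def vn trace_spectral[OF finJ s] by (subst sum.swap) (simp add: lam)
  finally show ?thesis .
qed

lemma psd_scale:
  assumes "psd J M" "c \<ge> 0"
  shows "psd J (\<lambda>j l. complex_of_real c * M j l)"
  unfolding psd_def
proof (intro conjI allI)
  have h: "hermitian_on J M" using assms by (simp add: psd_def)
  show "hermitian_on J (\<lambda>j l. complex_of_real c * M j l)"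
    unfolding hermitian_on_def by (simp add: hermitian_onD[OF h])
  have "qform J (\<lambda>j l. complex_of_real c * M j l) w = complex_of_real c * qform J M w" for w
    unfolding qform_def by (simp add: sum_distrib_left ac_simps)
  then show "Re (qform J (\<lambda>j l. complex_of_real c * M j l) w) \<ge> 0" for w
    using assms by (simp add: psd_def)
qed

text \<open>Apart from the factor \<open>c\<close>, scaling adds the same term, the trace times
  \<open>ent_term c\<close>, to the entropy and to the subtracted \<open>ent_term\<close> of the
  trace.\<close>

lemma excess_scale:
  assumes fin: "finite J" and p: "psd J M" and c: "c \<ge> 0"
  shows "excess J (\<lambda>j l. complex_of_real c * M j l) = c * excess J M"
proof -
  obtain lam u where s: "spectral J M lam u" and lam0: "\<And>i. i \<in> J \<Longrightarrow> lam i \<ge> 0"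
    and vn: "vn_entropy J M = (\<Sum>i\<in>J. ent_term (lam i))"
    using psd_spectral_obtain[OF fin p] by blast
  have "spectral J (\<lambda>j l. complex_of_real c * M j l) (\<lambda>i. c * lam i) u"
    using s unfolding spectral_def by (simp add: sum_distrib_left ac_simps)
  from vn_entropy_eq[OF fin psd_scale[OF p c] this]
  have vnc: "vn_entropy J (\<lambda>j l. complex_of_real c * M j l)
      = c * (\<Sum>i\<in>J. ent_term (lam i)) + (\<Sum>i\<in>J. lam i) * ent_term c"
    by (simp add: ent_term_mult c lam0 sum.distrib sum_distrib_left sum_distrib_right)
  have "(\<Sum>j\<in>J. Re (complex_of_real c * M j j)) = c * (\<Sum>i\<in>J. lam i)"
    by (simp add: sum_distrib_left[symmetric] trace_spectral[OF fin s])
  moreover have "(\<Sum>i\<in>J. lam i) \<ge> 0" using lam0 by (simp add: sum_nonneg)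
  ultimately show ?thesis
    unfolding excess_def vn vnc trace_spectral[OF fin s] by (simp add: ent_term_mult c algebra_simps)
qed

lemma vn_entropy_singleton:
  assumes "Re (M j j) \<ge> 0" "Im (M j j) = 0"
  shows "vn_entropy {j} M = ent_term (Re (M j j))"
proof -
  have s: "spectral {j} M (\<lambda>_. Re (M j j)) (\<lambda>_ _. 1)"
    using assms by (simp add: spectral_def orthonormal_def complex_eq_iff)
  from vn_entropy_eq[OF _ spectral_psd[OF s] s] assms show ?thesis by simp
qed

text \<open>Pairing an eigenbasis of $TT^*$ with one of $T^*T$, the matrix coefficient of $T$ between two
  eigenvectors vanishes unless the eigenvalues agree, and the squared moduli of the coefficients
  sum to the eigenvalues in each row and column.\<close>
lemma excess_gram_swap:
  fixes T :: "'i \<Rightarrow> 'k \<Rightarrow> complex"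
  assumes finI: "finite I" and finK: "finite K"
  shows "excess I (\<lambda>i j. \<Sum>k\<in>K. T i k * cnj (T j k)) = excess K (\<lambda>k l. \<Sum>i\<in>I. T i k * cnj (T i l))"
proof -
  let ?R = "\<lambda>i j. \<Sum>k\<in>K. T i k * cnj (T j k)" and ?S = "\<lambda>k l. \<Sum>i\<in>I. T i k * cnj (T i l)"
  have pR: "psd I ?R" by (rule psd_gram)
  have pS: "psd K ?S" using psd_gram[where J = K and K = I and T = "\<lambda>k i. T i k"] .
  obtain lam u where s: "spectral I ?R lam u" and lam0: "\<And>i. i \<in> I \<Longrightarrow> lam i \<ge> 0"
    and vnR: "vn_entropy I ?R = (\<Sum>i\<in>I. ent_term (lam i))"
    using psd_spectral_obtain[OF finI pR] by blast
  obtain mu v where s': "spectral K ?S mu v" and mu0: "\<And>k. k \<in> K \<Longrightarrow> mu k \<ge> 0"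
    and vnS: "vn_entropy K ?S = (\<Sum>k\<in>K. ent_term (mu k))"
    using psd_spectral_obtain[OF finK pS] by blast
  have u: "orthonormal I u" and v: "orthonormal K v" using s s' by (simp_all add: spectral_def)
  \<comment> \<open>\<open>?S\<close> is the entrywise conjugate of the adjoint of \<open>T\<close>
    times \<open>T\<close>, hence its eigenvectors enter conjugated.\<close>
  define t where "t i k = (\<Sum>a\<in>I. \<Sum>m\<in>K. cnj (u i a) * T a m * cnj (v k m))" for i k
  have eigR: "(\<Sum>a\<in>I. cnj (u i a) * ?R a b) = complex_of_real (lam i) * cnj (u i b)"
    if "i \<in> I" "b \<in> I" for i b
  proof -
    have "(\<Sum>a\<in>I. cnj (u i a) * ?R a b) = cnj (\<Sum>a\<in>I. ?R b a * u i a)"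
      by (simp add: ac_simps)
    then show ?thesis using spectral_eigenvector[OF finI s that] by simp
  qed
  have eigS: "(\<Sum>l\<in>K. ?S l m * cnj (v k l)) = complex_of_real (mu k) * cnj (v k m)"
    if "k \<in> K" "m \<in> K" for k m
  proof -
    have "(\<Sum>l\<in>K. ?S l m * cnj (v k l)) = cnj (\<Sum>l\<in>K. ?S m l * v k l)"
      by (simp add: ac_simps)
    then show ?thesis using spectral_eigenvector[OF finK s' that] by simp
  qed
  \<comment> \<open>The product of \<open>T\<close>, its adjoint and \<open>T\<close> is taken
    between the two eigenvectors and evaluated from the left and from the right.\<close>
  have inter: "complex_of_real (lam i) * t i k = complex_of_real (mu k) * t i k" if i: "i \<in> I" and k: "k \<in> K" for i k
  proof -
    have "complex_of_real (lam i) * t i k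
        = (\<Sum>b\<in>I. \<Sum>l\<in>K. (complex_of_real (lam i) * cnj (u i b)) * (T b l * cnj (v k l)))"
      by (simp add: t_def sum_distrib_left ac_simps)
    also have "\<dots> = (\<Sum>b\<in>I. \<Sum>l\<in>K. (\<Sum>a\<in>I. cnj (u i a) * ?R a b) * (T b l * cnj (v k l)))"
      using eigR[OF i] by (intro sum.cong refl) simp
    also have "\<dots> = (\<Sum>b\<in>I. \<Sum>l\<in>K. \<Sum>a\<in>I. \<Sum>m\<in>K. cnj (u i a) * T a m * cnj (T b m) * T b l * cnj (v k l))"
      by (simp add: sum_distrib_left sum_distrib_right ac_simps)
    also have "\<dots> = (\<Sum>b\<in>I. \<Sum>a\<in>I. \<Sum>l\<in>K. \<Sum>m\<in>K. cnj (u i a) * T a m * cnj (T b m) * T b l * cnj (v k l))"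
      by (intro sum.cong refl sum.swap)
    also have "\<dots> = (\<Sum>a\<in>I. \<Sum>b\<in>I. \<Sum>l\<in>K. \<Sum>m\<in>K. cnj (u i a) * T a m * cnj (T b m) * T b l * cnj (v k l))"
      by (rule sum.swap)
    also have "\<dots> = (\<Sum>a\<in>I. \<Sum>b\<in>I. \<Sum>m\<in>K. \<Sum>l\<in>K. cnj (u i a) * T a m * cnj (T b m) * T b l * cnj (v k l))"
      by (intro sum.cong refl sum.swap)
    also have "\<dots> = (\<Sum>a\<in>I. \<Sum>m\<in>K. \<Sum>b\<in>I. \<Sum>l\<in>K. cnj (u i a) * T a m * cnj (T b m) * T b l * cnj (v k l))"
      by (intro sum.cong refl sum.swap)
    also have "\<dots> = (\<Sum>a\<in>I. \<Sum>m\<in>K. \<Sum>l\<in>K. \<Sum>b\<in>I. cnj (u i a) * T a m * cnj (T b m) * T b l * cnj (v k l))"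
      by (intro sum.cong refl sum.swap)
    also have "\<dots> = (\<Sum>a\<in>I. \<Sum>m\<in>K. cnj (u i a) * T a m * (\<Sum>l\<in>K. ?S l m * cnj (v k l)))"
      by (simp add: sum_distrib_left sum_distrib_right ac_simps)
    also have "\<dots> = (\<Sum>a\<in>I. \<Sum>m\<in>K. cnj (u i a) * T a m * (complex_of_real (mu k) * cnj (v k m)))"
      using eigS[OF k] by (intro sum.cong refl) simp
    also have "\<dots> = complex_of_real (mu k) * t i k"
      by (simp add: t_def sum_distrib_left ac_simps)
    finally show ?thesis .
  qed
  have row: "(\<Sum>k\<in>K. (cmod (t i k))\<^sup>2) = lam i" if i: "i \<in> I" for i
  proof -
    define x where "x m = (\<Sum>a\<in>I. cnj (u i a) * T a m)" for m
    have "t i k = (\<Sum>m\<in>K. cnj (v k m) * x m)" for k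
      unfolding t_def x_def by (subst sum.swap) (simp add: sum_distrib_left ac_simps)
    then have "(\<Sum>k\<in>K. (cmod (t i k))\<^sup>2) = (\<Sum>m\<in>K. (cmod (x m))\<^sup>2)"
      using parseval[OF finK v, of x] by simp
    also have "\<dots> = (\<Sum>m\<in>K. 1 * (cmod (\<Sum>a\<in>I. cnj (T a m) * u i a))\<^sup>2)"
    proof (intro sum.cong refl)
      fix m
      have "x m = cnj (\<Sum>a\<in>I. cnj (T a m) * u i a)" by (simp add: x_def mult.commute)
      then show "(cmod (x m))\<^sup>2 = 1 * (cmod (\<Sum>a\<in>I. cnj (T a m) * u i a))\<^sup>2"
        by (simp only: complex_mod_cnj mult_1)
    qed
    also have "\<dots> = Re (qform I ?R (u i))"
      by (subst qform_rank_one_sum[where K = K and lam = "\<lambda>_. 1" and T = "\<lambda>k j. T j k"]) simp_all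
    also have "\<dots> = lam i" by (rule qform_eigenvector[OF finI s i])
    finally show ?thesis .
  qed
  have col: "(\<Sum>i\<in>I. (cmod (t i k))\<^sup>2) = mu k" if k: "k \<in> K" for k
  proof -
    define x where "x a = (\<Sum>m\<in>K. T a m * cnj (v k m))" for a
    have "t i k = (\<Sum>a\<in>I. cnj (u i a) * x a)" for i
      unfolding t_def x_def by (simp add: sum_distrib_left ac_simps)
    then have "(\<Sum>i\<in>I. (cmod (t i k))\<^sup>2) = (\<Sum>a\<in>I. (cmod (x a))\<^sup>2)"
      using parseval[OF finI u, of x] by simp
    also have "\<dots> = (\<Sum>a\<in>I. 1 * (cmod (\<Sum>m\<in>K. cnj (T a m) * v k m))\<^sup>2)"
    proof (intro sum.cong refl)
      fix a
      have "x a = cnj (\<Sum>m\<in>K. cnj (T a m) * v k m)" by (simp add: x_def mult.commute)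
      then show "(cmod (x a))\<^sup>2 = 1 * (cmod (\<Sum>m\<in>K. cnj (T a m) * v k m))\<^sup>2"
        by (simp only: complex_mod_cnj mult_1)
    qed
    also have "\<dots> = Re (qform K ?S (v k))"
      by (subst qform_rank_one_sum[where K = I and lam = "\<lambda>_. 1" and T = T]) simp_all
    also have "\<dots> = mu k" by (rule qform_eigenvector[OF finK s' k])
    finally show ?thesis .
  qed
  have "(\<Sum>i\<in>I. ent_term (lam i)) = (\<Sum>i\<in>I. \<Sum>k\<in>K. - ((cmod (t i k))\<^sup>2 * log 2 (lam i)))"
    by (simp add: lam0 ent_term_altdef sum_negf sum_distrib_right[symmetric] row)
  \<comment> \<open>By \<open>inter\<close>, \<open>lam i\<close> and \<open>mu k\<close> agree
    wherever \<open>t i k\<close> is nonzero.\<close>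
  also have "\<dots> = (\<Sum>i\<in>I. \<Sum>k\<in>K. - ((cmod (t i k))\<^sup>2 * log 2 (mu k)))"
    using inter by (intro sum.cong refl) fastforce
  also have "\<dots> = (\<Sum>k\<in>K. \<Sum>i\<in>I. - ((cmod (t i k))\<^sup>2 * log 2 (mu k)))" by (rule sum.swap)
  also have "\<dots> = (\<Sum>k\<in>K. ent_term (mu k))"
    by (simp add: mu0 ent_term_altdef sum_negf sum_distrib_right[symmetric] col)
  finally have "vn_entropy I ?R = vn_entropy K ?S" using vnR vnS by simp
  moreover have "(\<Sum>i\<in>I. Re (?R i i)) = (\<Sum>k\<in>K. Re (?S k k))"
    by (simp only: Re_sum) (rule sum.swap)
  ultimately show ?thesis by (simp only: excess_def)
qed

section \<open>Entropies of a measured four-register state\<close>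

text \<open>The exchange of Alice and Bob: results about one party are carried over to the other
  through it.\<close>

definition swap_regs :: "('a \<times> nat \<times> 'b \<times> nat \<Rightarrow> complex) \<Rightarrow> ('b \<times> nat \<times> 'a \<times> nat \<Rightarrow> complex)" where
  "swap_regs psi = (\<lambda>(y, b, x, a). psi (x, a, y, b))"

lemma swap_regs_apply [simp]: "swap_regs psi (y, b, x, a) = psi (x, a, y, b)"
  by (simp add: swap_regs_def)

lemma swap_regs_swap_regs [simp]: "swap_regs (swap_regs psi) = psi"
  by (simp add: fun_eq_iff)

definition has_law :: "'a set \<Rightarrow> 'b set \<Rightarrow> ('a \<Rightarrow> 'b \<Rightarrow> real) \<Rightarrow> nat \<Rightarrow> nat \<Rightarrow>
    ('a \<times> nat \<times> 'b \<times> nat \<Rightarrow> complex) \<Rightarrow> bool" where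
  "has_law SX SY P dA dB psi \<longleftrightarrow>
     (\<forall>x\<in>SX. \<forall>y\<in>SY. (\<Sum>a<dA. \<Sum>b<dB. (cmod (psi (x, a, y, b)))\<^sup>2) = P x y)"

text \<open>The unnormalised state of $AA'$ after the outcome $y$ on $B$.\<close>
definition cond_state :: "nat \<Rightarrow> ('a \<times> nat \<times> 'b \<times> nat \<Rightarrow> complex) \<Rightarrow> 'b \<Rightarrow>
    'a \<times> nat \<Rightarrow> 'a \<times> nat \<Rightarrow> complex" where
  "cond_state dB psi y i j =
     (\<Sum>b<dB. psi (fst i, snd i, y, b) * cnj (psi (fst j, snd j, y, b)))"

text \<open>For a normalised state, this quantity and the next two are the entropies S(A'|XY),
  S(A'|X) and S(AA'). On \<open>swap_regs psi\<close> they give those of Bob.\<close>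

definition excess_XY where
  "excess_XY SX dA SY dB psi =
     (\<Sum>x\<in>SX. \<Sum>y\<in>SY. excess {..<dA} (\<lambda>a a'. cond_state dB psi y (x, a) (x, a')))"

definition excess_X where
  "excess_X SX dA SY dB psi =
     (\<Sum>x\<in>SX. excess {..<dA} (\<lambda>a a'. \<Sum>y\<in>SY. cond_state dB psi y (x, a) (x, a')))"

definition excess_AA where
  "excess_AA SX dA SY dB psi =
     excess (SX \<times> {..<dA}) (\<lambda>i j. \<Sum>y\<in>SY. cond_state dB psi y i j)"

lemma has_law_swap:
  "has_law SX SY P dA dB psi \<Longrightarrow> has_law SY SX (\<lambda>y x. P x y) dB dA (swap_regs psi)"
  unfolding has_law_def by (auto intro: trans[OF sum.swap])

lemma psd_cond_state: "psd J (cond_state dB psi y)"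
  unfolding cond_state_def by (rule psd_gram)

lemma psd_cond_state_x: "psd J (\<lambda>a a'. cond_state dB psi y (x, a) (x, a'))"
  unfolding cond_state_def fst_conv snd_conv by (rule psd_gram)

lemma cond_state_trace:
  assumes "has_law SX SY P dA dB psi" "x \<in> SX" "y \<in> SY"
  shows "(\<Sum>a<dA. Re (cond_state dB psi y (x, a) (x, a))) = P x y"
  using assms by (simp add: has_law_def cond_state_def complex_mult_cnj cmod_power2)

lemma sum_quadruple:
  "(\<Sum>(t1, t2, t3, t4)\<in>A \<times> B \<times> C \<times> D. h t1 t2 t3 t4) =
   (\<Sum>t1\<in>A. \<Sum>t2\<in>B. \<Sum>t3\<in>C. \<Sum>t4\<in>D. h t1 t2 t3 t4)"
  by (simp add: sum.cartesian_product)

lemma sum_pair: "(\<Sum>p\<in>A \<times> B. h p) = (\<Sum>a\<in>A. \<Sum>b\<in>B. h (a, b))"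
  by (simp add: sum.cartesian_product)

text \<open>Given both outcomes the state of A'B' is pure, so its two halves have equal
  entropy.\<close>

lemma excess_XY_swap: "excess_XY SX dA SY dB psi = excess_XY SY dB SX dA (swap_regs psi)"
proof -
  have "excess {..<dA} (\<lambda>a a'. cond_state dB psi y (x, a) (x, a'))
      = excess {..<dB} (\<lambda>b b'. cond_state dA (swap_regs psi) x (y, b) (y, b'))" for x y
    using excess_gram_swap[of "{..<dA}" "{..<dB}" "\<lambda>a b. psi (x, a, y, b)"]
    by (simp add: cond_state_def)
  then show ?thesis unfolding excess_XY_def by (subst sum.swap) simp
qed

text \<open>The Schmidt decomposition across the cut between AA' and BB'.\<close>

lemma excess_AA_swap:
  assumes "finite SX" "finite SY"
  shows "excess_AA SX dA SY dB psi = excess_AA SY dB SX dA (swap_regs psi)"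
  using excess_gram_swap[of "SX \<times> {..<dA}" "SY \<times> {..<dB}"
      "\<lambda>i k. psi (fst i, snd i, fst k, snd k)"] assms
  by (simp add: excess_AA_def cond_state_def sum_pair)

text \<open>After the outcome \<open>y\<close> the state of AA'B' is pure, so the entropy of AA' is
  that of B'.\<close>

lemma excess_AA_cond_state:
  assumes "finite SX"
  shows "excess (SX \<times> {..<dA}) (cond_state dB psi y)
    = excess {..<dB} (\<lambda>b b'. \<Sum>x\<in>SX. cond_state dA (swap_regs psi) x (y, b) (y, b'))"
  using excess_gram_swap[of "SX \<times> {..<dA}" "{..<dB}" "\<lambda>i b. psi (fst i, snd i, y, b)"] assms
  by (simp add: cond_state_def[abs_def] sum_pair)

lemma Sred_swap:
  "Sred (m1, m2, m3, m4) SX dA SY dB psi = Sred (m3, m4, m1, m2) SY dB SX dA (swap_regs psi)"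
proof -
  let ?f = "\<lambda>(y, b, x, a). (x, a, y, b)"
  have f1: "bij_betw ?f (red_idx (m3, m4, m1, m2) SY dB SX dA) (red_idx (m1, m2, m3, m4) SX dA SY dB)"
    by (rule bij_betw_byWitness[where f' = "\<lambda>(x, a, y, b). (y, b, x, a)"]) (auto simp: red_idx_def)
  have f2: "bij_betw ?f (tr_idx (m3, m4, m1, m2) SY dB SX dA) (tr_idx (m1, m2, m3, m4) SX dA SY dB)"
    by (rule bij_betw_byWitness[where f' = "\<lambda>(x, a, y, b). (y, b, x, a)"]) (auto simp: tr_idx_def)
  have "red_mat (m1, m2, m3, m4) SX dA SY dB psi (?f i) (?f j)
      = red_mat (m3, m4, m1, m2) SY dB SX dA (swap_regs psi) i j" for i j
    unfolding red_mat_def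
    by (cases i; cases j) (simp add: sum.reindex_bij_betw[OF f2, symmetric] case_prod_beta conj_commute conj_left_commute)
  then show ?thesis
    unfolding Sred_def vn_entropy_reindex[OF f1] by simp
qed

lemma vn_entropy_excess: "vn_entropy J M = excess J M + ent_term (\<Sum>j\<in>J. Re (M j j))"
  by (simp add: excess_def)

section \<open>Entropies of the reduced states as excess plus Shannon entropy\<close>

lemma Sred_X:
  assumes "finite SX" "finite SY" and law: "has_law SX SY P dA dB psi"
  shows "Sred (Meas, Tr, Tr, Tr) SX dA SY dB psi = (\<Sum>x\<in>SX. ent_term (margX SY P x))"
proof -
  let ?M = "\<lambda>x (_::unit) (_::unit). complex_of_real (margX SY P x)"
  have marg: "(\<Sum>a<dA. \<Sum>y\<in>SY. \<Sum>b<dB. psi (x, a, y, b) * cnj (psi (x, a, y, b))) = complex_of_real (margX SY P x)"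
    if "x \<in> SX" for x
    using law that unfolding has_law_def margX_def
    by (subst sum.swap) (simp add: complex_norm_square[symmetric] flip: of_real_power of_real_sum)
  have nonneg: "margX SY P x \<ge> 0" if "x \<in> SX" for x
    using law that unfolding has_law_def margX_def by (metis (no_types, lifting) sum_nonneg zero_le_power2)
  have "Sred (Meas, Tr, Tr, Tr) SX dA SY dB psi = (\<Sum>x\<in>SX. vn_entropy {()} (?M x))"
    unfolding Sred_def
  proof (rule vn_entropy_blocks[where f = "\<lambda>(x, _). (x, undefined, undefined, undefined)"])
    show "bij_betw (\<lambda>(x, _). (x, undefined, undefined, undefined)) (SX \<times> {()})
        (red_idx (Meas, Tr, Tr, Tr) SX dA SY dB)"
      by (rule bij_betw_byWitness[where f' = "\<lambda>(x, _). (x, ())"]) (auto simp: red_idx_def keep_set_def)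
    show "psd {()} (?M x)" if "x \<in> SX" for x
      by (rule psd_rank_one_sum[where K = "{()}" and lam = "\<lambda>_. margX SY P x" and T = "\<lambda>_ _. 1"])
        (simp_all add: nonneg[OF that])
  qed (use assms in \<open>auto simp: red_mat_def tr_idx_def tr_set_def sum_quadruple mrg_def dg_def marg\<close>)
  also have "\<dots> = (\<Sum>x\<in>SX. ent_term (margX SY P x))"
    by (intro sum.cong refl) (simp add: vn_entropy_singleton nonneg)
  finally show ?thesis .
qed

lemma Sred_XA:
  assumes "finite SX" "finite SY" and law: "has_law SX SY P dA dB psi"
  shows "Sred (Meas, Keep, Tr, Tr) SX dA SY dB psi
    = excess_X SX dA SY dB psi + (\<Sum>x\<in>SX. ent_term (margX SY P x))"
proof -
  let ?M = "\<lambda>x a a'. \<Sum>y\<in>SY. cond_state dB psi y (x, a) (x, a')"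
  have "Sred (Meas, Keep, Tr, Tr) SX dA SY dB psi = (\<Sum>x\<in>SX. vn_entropy {..<dA} (?M x))"
    unfolding Sred_def
  proof (rule vn_entropy_blocks[where f = "\<lambda>(x, a). (x, a, undefined, undefined)"])
    show "bij_betw (\<lambda>(x, a). (x, a, undefined, undefined)) (SX \<times> {..<dA})
        (red_idx (Meas, Keep, Tr, Tr) SX dA SY dB)"
      by (rule bij_betw_byWitness[where f' = "\<lambda>(x, a, _, _). (x, a)"]) (auto simp: red_idx_def keep_set_def)
    show "psd {..<dA} (?M x)" for x by (intro psd_sum psd_cond_state_x)
  qed (use assms in \<open>auto simp: red_mat_def tr_idx_def tr_set_def sum_quadruple mrg_def dg_def cond_state_def\<close>)
  also have "\<dots> = (\<Sum>x\<in>SX. excess {..<dA} (?M x) + ent_term (margX SY P x))"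
  proof (intro sum.cong refl)
    fix x assume x: "x \<in> SX"
    have "(\<Sum>a<dA. Re (?M x a a)) = (\<Sum>y\<in>SY. \<Sum>a<dA. Re (cond_state dB psi y (x, a) (x, a)))"
      unfolding Re_sum by (rule sum.swap)
    also have "\<dots> = margX SY P x"
      unfolding margX_def by (intro sum.cong refl cond_state_trace[OF law x])
    finally show "vn_entropy {..<dA} (?M x) = excess {..<dA} (?M x) + ent_term (margX SY P x)"
      by (simp only: vn_entropy_excess)
  qed
  finally show ?thesis by (simp only: excess_X_def sum.distrib)
qed

lemma Sred_XAY:
  assumes "finite SX" "finite SY" and law: "has_law SX SY P dA dB psi"
  shows "Sred (Meas, Keep, Meas, Tr) SX dA SY dB psi
    = excess_XY SX dA SY dB psi + (\<Sum>x\<in>SX. \<Sum>y\<in>SY. ent_term (P x y))"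
proof -
  let ?M = "\<lambda>p a a'. cond_state dB psi (snd p) (fst p, a) (fst p, a')"
  have "Sred (Meas, Keep, Meas, Tr) SX dA SY dB psi = (\<Sum>p\<in>SX \<times> SY. vn_entropy {..<dA} (?M p))"
    unfolding Sred_def
  proof (rule vn_entropy_blocks[where f = "\<lambda>((x, y), a). (x, a, y, undefined)"])
    show "bij_betw (\<lambda>((x, y), a). (x, a, y, undefined)) ((SX \<times> SY) \<times> {..<dA})
        (red_idx (Meas, Keep, Meas, Tr) SX dA SY dB)"
      by (rule bij_betw_byWitness[where f' = "\<lambda>(x, a, y, _). ((x, y), a)"]) (auto simp: red_idx_def keep_set_def)
    show "psd {..<dA} (?M p)" for p by (rule psd_cond_state_x)
  qed (use assms in \<open>auto simp: red_mat_def tr_idx_def tr_set_def sum_quadruple mrg_def dg_def cond_state_def split: if_splits\<close>)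
  also have "\<dots> = (\<Sum>x\<in>SX. \<Sum>y\<in>SY. vn_entropy {..<dA} (?M (x, y)))"
    by (rule sum_pair)
  also have "\<dots> = (\<Sum>x\<in>SX. \<Sum>y\<in>SY. excess {..<dA} (?M (x, y)) + ent_term (P x y))"
    using cond_state_trace[OF law] by (intro sum.cong refl) (simp add: vn_entropy_excess)
  finally show ?thesis by (simp add: excess_XY_def sum.distrib)
qed

lemma Sred_AA:
  assumes fin: "finite SX" "finite SY" and law: "has_law SX SY P dA dB psi"
  shows "Sred (Keep, Keep, Tr, Tr) SX dA SY dB psi
    = excess_AA SX dA SY dB psi + ent_term (\<Sum>x\<in>SX. \<Sum>y\<in>SY. P x y)"
proof -
  let ?M = "\<lambda>i j. \<Sum>y\<in>SY. cond_state dB psi y i j"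
  \<comment> \<open>The single block serves only to remove the dummy coordinates of the index
    set.\<close>
  have "Sred (Keep, Keep, Tr, Tr) SX dA SY dB psi = (\<Sum>_\<in>{()}. vn_entropy (SX \<times> {..<dA}) ?M)"
    unfolding Sred_def
  proof (rule vn_entropy_blocks[where f = "\<lambda>(_, x, a). (x, a, undefined, undefined)"])
    show "bij_betw (\<lambda>(_, x, a). (x, a, undefined, undefined)) ({()} \<times> SX \<times> {..<dA})
        (red_idx (Keep, Keep, Tr, Tr) SX dA SY dB)"
      by (rule bij_betw_byWitness[where f' = "\<lambda>(x, a, _, _). ((), x, a)"]) (auto simp: red_idx_def keep_set_def)
    show "psd (SX \<times> {..<dA}) ?M" by (intro psd_sum psd_cond_state)
  qed (use assms in \<open>auto simp: red_mat_def tr_idx_def tr_set_def sum_quadruple mrg_def dg_def cond_state_def\<close>)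
  moreover have "(\<Sum>i\<in>SX \<times> {..<dA}. Re (?M i i)) = (\<Sum>x\<in>SX. \<Sum>y\<in>SY. P x y)"
  proof -
    have "(\<Sum>i\<in>SX \<times> {..<dA}. Re (?M i i))
        = (\<Sum>x\<in>SX. \<Sum>a<dA. \<Sum>y\<in>SY. Re (cond_state dB psi y (x, a) (x, a)))"
      by (simp only: sum_pair Re_sum)
    also have "\<dots> = (\<Sum>x\<in>SX. \<Sum>y\<in>SY. \<Sum>a<dA. Re (cond_state dB psi y (x, a) (x, a)))"
      by (intro sum.cong refl sum.swap)
    finally show ?thesis by (simp add: cond_state_trace[OF law])
  qed
  ultimately show ?thesis by (simp add: excess_AA_def vn_entropy_excess)
qed

text \<open>The blocks are the states of AA' given \<open>y\<close>;
  \<open>excess_AA_cond_state\<close> replaces their excess by that of B', which makes the total an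
  \<open>excess_X\<close> of the swapped state.\<close>

lemma Sred_AAY:
  assumes fin: "finite SX" "finite SY" and law: "has_law SX SY P dA dB psi"
  shows "Sred (Keep, Keep, Meas, Tr) SX dA SY dB psi
    = excess_X SY dB SX dA (swap_regs psi) + (\<Sum>y\<in>SY. ent_term (margY SX P y))"
proof -
  let ?M = "cond_state dB psi"
  have "Sred (Keep, Keep, Meas, Tr) SX dA SY dB psi = (\<Sum>y\<in>SY. vn_entropy (SX \<times> {..<dA}) (?M y))"
    unfolding Sred_def
  proof (rule vn_entropy_blocks[where f = "\<lambda>(y, x, a). (x, a, y, undefined)"])
    show "bij_betw (\<lambda>(y, x, a). (x, a, y, undefined)) (SY \<times> SX \<times> {..<dA})
        (red_idx (Keep, Keep, Meas, Tr) SX dA SY dB)"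
      by (rule bij_betw_byWitness[where f' = "\<lambda>(x, a, y, _). (y, x, a)"]) (auto simp: red_idx_def keep_set_def)
    show "psd (SX \<times> {..<dA}) (?M y)" for y by (rule psd_cond_state)
  qed (use assms in \<open>auto simp: red_mat_def tr_idx_def tr_set_def sum_quadruple mrg_def dg_def cond_state_def\<close>)
  also have "\<dots> = (\<Sum>y\<in>SY. excess (SX \<times> {..<dA}) (?M y) + ent_term (margY SX P y))"
  proof (intro sum.cong refl)
    fix y assume y: "y \<in> SY"
    have "(\<Sum>i\<in>SX \<times> {..<dA}. Re (?M y i i)) = (\<Sum>x\<in>SX. \<Sum>a<dA. Re (?M y (x, a) (x, a)))"
      by (simp only: sum_pair)
    also have "\<dots> = margY SX P y"
      unfolding margY_def by (intro sum.cong refl cond_state_trace[OF law _ y])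
    finally show "vn_entropy (SX \<times> {..<dA}) (?M y) = excess (SX \<times> {..<dA}) (?M y) + ent_term (margY SX P y)"
      by (simp only: vn_entropy_excess)
  qed
  finally show ?thesis
    by (simp only: excess_X_def sum.distrib excess_AA_cond_state[OF fin(1)])
qed

section \<open>Mutual informations, embeddings and leakage in terms of the excess\<close>

lemma margX_transpose: "margX SX (\<lambda>y x. P x y) = margY SX P"
  by (simp add: margX_def margY_def fun_eq_iff)

lemma margY_transpose: "margY SY (\<lambda>y x. P x y) = margX SY P"
  by (simp add: margX_def margY_def fun_eq_iff)

lemma shannon_mi_transpose: "shannon_mi SY SX (\<lambda>y x. P x y) = shannon_mi SX SY P"
  unfolding shannon_mi_def margX_transpose[of SX P] margY_transpose[of SY P]
  by (subst sum.swap[of _ SX SY]) simp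

text \<open>The chain rule: the surplus of S(XA';Y) over I(X;Y) is S(A'|X) - S(A'|XY).\<close>

lemma S_XA'_Y_eq:
  assumes "finite SX" "finite SY" "has_law SX SY P dA dB psi"
  shows "S_XA'_Y SX dA SY dB psi
    = shannon_mi SX SY P + excess_X SX dA SY dB psi - excess_XY SX dA SY dB psi"
  unfolding S_XA'_Y_def Smi_def shannon_mi_def Sred_XA[OF assms] Sred_XAY[OF assms]
    Sred_swap[of Tr Tr Meas Tr] Sred_X[OF assms(2,1) has_law_swap[OF assms(3)]] margX_transpose[of SX P]
  by simp

lemma S_AA'_Y_eq:
  assumes "finite SX" "finite SY" "has_law SX SY P dA dB psi" "(\<Sum>x\<in>SX. \<Sum>y\<in>SY. P x y) = 1"
  shows "S_AA'_Y SX dA SY dB psi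
    = excess_AA SX dA SY dB psi - excess_X SY dB SX dA (swap_regs psi)"
  unfolding S_AA'_Y_def Smi_def Sred_AA[OF assms(1-3)] Sred_AAY[OF assms(1-3)]
    Sred_swap[of Tr Tr Meas Tr] Sred_X[OF assms(2,1) has_law_swap[OF assms(3)]] margX_transpose[of SX P] assms(4)
  by (simp add: ent_term_def)

lemma S_X_YB'_swap: "S_X_YB' SX dA SY dB psi = S_XA'_Y SY dB SX dA (swap_regs psi)"
  unfolding S_X_YB'_def S_XA'_Y_def Smi_def
    Sred_swap[of Meas Tr Tr Tr SX] Sred_swap[of Tr Tr Meas Keep SX] Sred_swap[of Meas Tr Meas Keep SX]
  by simp

lemma S_X_BB'_swap: "S_X_BB' SX dA SY dB psi = S_AA'_Y SY dB SX dA (swap_regs psi)"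
  unfolding S_X_BB'_def S_AA'_Y_def Smi_def
    Sred_swap[of Meas Tr Tr Tr SX] Sred_swap[of Tr Tr Keep Keep SX] Sred_swap[of Meas Tr Keep Keep SX]
  by simp

text \<open>Both entropic conditions say that superadditivity of the excess is tight: A' tells
  nothing about Y beyond X, and B' nothing about X beyond Y. By \<open>excess_XY_swap\<close> the
  two have the same right-hand side.\<close>

lemma is_embedding_iff:
  assumes "finite SX" "finite SY"
  shows "is_embedding SX SY P dA dB psi \<longleftrightarrow> dA \<ge> 1 \<and> dB \<ge> 1 \<and> has_law SX SY P dA dB psi \<and>
    excess_X SX dA SY dB psi = excess_XY SX dA SY dB psi \<and>
    excess_X SY dB SX dA (swap_regs psi) = excess_XY SX dA SY dB psi"
proof (cases "has_law SX SY P dA dB psi")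
  case True
  have "S_X_YB' SX dA SY dB psi = shannon_mi SX SY P
      + excess_X SY dB SX dA (swap_regs psi) - excess_XY SX dA SY dB psi"
    unfolding S_X_YB'_swap S_XA'_Y_eq[OF assms(2,1) has_law_swap[OF True]]
      shannon_mi_transpose[of SY SX P] excess_XY_swap[of SX dA SY dB psi] by simp
  then show ?thesis
    unfolding is_embedding_def has_law_def[symmetric] S_XA'_Y_eq[OF assms True] by auto
next
  case False
  then show ?thesis unfolding is_embedding_def has_law_def[symmetric] by simp
qed

text \<open>Under the embedding conditions, and because S(AA') = S(BB'), the two parties' leakages
  coincide. The maximum is gone, so an average of this one expression controls both leakages at
  once.\<close>

lemma emb_leakage_eq:
  assumes fin: "finite SX" "finite SY" and total: "(\<Sum>x\<in>SX. \<Sum>y\<in>SY. P x y) = 1"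
    and emb: "is_embedding SX SY P dA dB psi"
  shows "emb_leakage SX SY P dA dB psi
    = excess_AA SX dA SY dB psi - excess_XY SX dA SY dB psi - shannon_mi SX SY P"
proof -
  have law: "has_law SX SY P dA dB psi" and eqs: "excess_X SX dA SY dB psi = excess_XY SX dA SY dB psi"
    "excess_X SY dB SX dA (swap_regs psi) = excess_XY SX dA SY dB psi"
    using emb is_embedding_iff[OF fin] by auto
  have total': "(\<Sum>y\<in>SY. \<Sum>x\<in>SX. P x y) = 1" using total by (subst sum.swap)
  show ?thesis
    unfolding emb_leakage_def S_AA'_Y_eq[OF fin law total] S_X_BB'_swap
      S_AA'_Y_eq[OF fin(2,1) has_law_swap[OF law] total'] excess_AA_swap[OF fin(2,1)]
    by (simp add: eqs)
qed

lemma is_embedding_swap: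
  assumes "finite SX" "finite SY" "is_embedding SX SY P dA dB psi"
  shows "is_embedding SY SX (\<lambda>y x. P x y) dB dA (swap_regs psi)"
  using assms(3) unfolding is_embedding_iff[OF assms(1,2)] is_embedding_iff[OF assms(2,1)]
  by (auto simp: has_law_swap excess_XY_swap[of SX dA SY])

section \<open>Coarse graining by a random choice of representatives\<close>

text \<open>The product expands into a sum over choices; every coordinate but \<open>v0\<close> sums
  to 1, so under the product law \<open>w v0\<close> is distributed by \<open>q\<close>.\<close>

lemma sum_PiE_prod_component:
  fixes q :: "'b \<Rightarrow> 'r::comm_ring_1"
  assumes finV: "finite V" and finC: "\<And>v. v \<in> V \<Longrightarrow> finite (C v)"
    and q1: "\<And>v. v \<in> V \<Longrightarrow> (\<Sum>y\<in>C v. q y) = 1" and v0: "v0 \<in> V"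
  shows "(\<Sum>w\<in>PiE V C. (\<Prod>v\<in>V. q (w v)) * f (w v0)) = (\<Sum>y\<in>C v0. q y * f y)"
proof -
  let ?k = "\<lambda>v y. if v = v0 then q y * f y else q y"
  have "(\<Prod>v\<in>V. q (w v)) * f (w v0) = (\<Prod>v\<in>V. ?k v (w v))" for w
    unfolding prod.remove[OF finV v0] by (simp add: ac_simps)
  then have "(\<Sum>w\<in>PiE V C. (\<Prod>v\<in>V. q (w v)) * f (w v0)) = (\<Sum>w\<in>PiE V C. \<Prod>v\<in>V. ?k v (w v))"
    by simp
  also have "\<dots> = (\<Prod>v\<in>V. \<Sum>y\<in>C v. ?k v y)"
    by (rule prod_sum_PiE[symmetric]) (use finV finC in auto)
  also have "\<dots> = (\<Sum>y\<in>C v0. q y * f y)"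
    unfolding prod.remove[OF finV v0] by (simp add: q1)
  finally show ?thesis .
qed

text \<open>A random choice of one representative \<open>w v \<in> C v\<close> for each \<open>v \<in> V\<close>, independently with
  law \<open>q\<close> on \<open>C v\<close>.\<close>
locale random_choice =
  fixes V :: "'c set" and C :: "'c \<Rightarrow> 'b set" and q :: "'b \<Rightarrow> real"
  assumes finV: "finite V" and finC: "\<And>v. v \<in> V \<Longrightarrow> finite (C v)"
    and q_pos: "\<And>v y. v \<in> V \<Longrightarrow> y \<in> C v \<Longrightarrow> q y > 0"
    and q_sum: "\<And>v. v \<in> V \<Longrightarrow> (\<Sum>y\<in>C v. q y) = 1"
begin

definition Q :: "('c \<Rightarrow> 'b) \<Rightarrow> real" where
  "Q w = (\<Prod>v\<in>V. q (w v))"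

lemma finite_W: "finite (PiE V C)"
  using finV finC by (rule finite_PiE)

lemma W_component_pos: "w \<in> PiE V C \<Longrightarrow> v \<in> V \<Longrightarrow> q (w v) > 0"
  using q_pos by (auto simp: PiE_def Pi_def)

lemma Q_pos: "w \<in> PiE V C \<Longrightarrow> Q w > 0"
  unfolding Q_def by (intro prod_pos) (simp add: W_component_pos)

lemma Q_sum: "(\<Sum>w\<in>PiE V C. Q w) = 1"
proof -
  have "(\<Sum>w\<in>PiE V C. Q w) = (\<Prod>v\<in>V. \<Sum>y\<in>C v. q y)"
    unfolding Q_def by (rule prod_sum_PiE[symmetric]) (use finV finC in auto)
  then show ?thesis by (simp add: q_sum)
qed

text \<open>The representative \<open>y\<close> is drawn with probability \<open>q y\<close>, and
  the weight \<open>1 / q y\<close> compensates for this: the weighted sum over the drawn values is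
  an unbiased estimate of the full sum.\<close>

lemma average_complex:
  fixes f :: "'b \<Rightarrow> complex"
  shows "(\<Sum>w\<in>PiE V C. complex_of_real (Q w) * (\<Sum>v\<in>V. complex_of_real (1 / q (w v)) * f (w v)))
    = (\<Sum>v\<in>V. \<Sum>y\<in>C v. f y)"
proof -
  have "(\<Sum>w\<in>PiE V C. complex_of_real (Q w) * (\<Sum>v\<in>V. complex_of_real (1 / q (w v)) * f (w v)))
      = (\<Sum>v\<in>V. \<Sum>w\<in>PiE V C. (\<Prod>v\<in>V. complex_of_real (q (w v))) * (complex_of_real (1 / q (w v)) * f (w v)))"
    unfolding sum_distrib_left Q_def of_real_prod by (rule sum.swap)
  also have "\<dots> = (\<Sum>v\<in>V. \<Sum>y\<in>C v. complex_of_real (q y) * (complex_of_real (1 / q y) * f y))"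
    using finV finC q_sum
    by (intro sum.cong refl sum_PiE_prod_component) (auto simp flip: of_real_sum)
  also have "\<dots> = (\<Sum>v\<in>V. \<Sum>y\<in>C v. f y)"
  proof (intro sum.cong refl)
    fix v y assume "v \<in> V" "y \<in> C v"
    then have "q y \<noteq> 0" using q_pos by fastforce
    then show "complex_of_real (q y) * (complex_of_real (1 / q y) * f y) = f y" by simp
  qed
  finally show ?thesis .
qed

lemma average_real:
  fixes f :: "'b \<Rightarrow> real"
  shows "(\<Sum>w\<in>PiE V C. Q w * (\<Sum>v\<in>V. (1 / q (w v)) * f (w v))) = (\<Sum>v\<in>V. \<Sum>y\<in>C v. f y)"
proof -
  have "complex_of_real (\<Sum>w\<in>PiE V C. Q w * (\<Sum>v\<in>V. (1 / q (w v)) * f (w v)))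
      = complex_of_real (\<Sum>v\<in>V. \<Sum>y\<in>C v. f y)"
    using average_complex[of "\<lambda>y. complex_of_real (f y)"] by simp
  then show ?thesis by (simp only: of_real_eq_iff)
qed

text \<open>The sampled matrices average to the full sum by \<open>average_complex\<close>.
  Homogeneity moves the weights \<open>Q w\<close> into the excess, and superadditivity gives the
  inequality.\<close>

lemma average_excess:
  assumes finJ: "finite J" and p: "\<And>y. psd J (N y)"
  shows "(\<Sum>w\<in>PiE V C. Q w * excess J (\<lambda>i j. \<Sum>v\<in>V. complex_of_real (1 / q (w v)) * N (w v) i j))
    \<le> excess J (\<lambda>i j. \<Sum>v\<in>V. \<Sum>y\<in>C v. N y i j)"
proof -
  let ?R = "\<lambda>w i j. \<Sum>v\<in>V. complex_of_real (1 / q (w v)) * N (w v) i j"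
  have pR: "psd J (?R w)" if "w \<in> PiE V C" for w
    using W_component_pos[OF that] by (intro psd_sum psd_scale p) (simp add: less_imp_le)
  have "(\<Sum>w\<in>PiE V C. Q w * excess J (?R w))
      = (\<Sum>w\<in>PiE V C. excess J (\<lambda>i j. complex_of_real (Q w) * ?R w i j))"
    using Q_pos by (intro sum.cong refl excess_scale[symmetric] finJ pR) (simp_all add: less_imp_le)
  also have "\<dots> \<le> excess J (\<lambda>i j. \<Sum>w\<in>PiE V C. complex_of_real (Q w) * ?R w i j)"
    using Q_pos by (intro excess_superadditive finJ finite_W psd_scale pR) (simp_all add: less_imp_le)
  also have "\<dots> = excess J (\<lambda>i j. \<Sum>v\<in>V. \<Sum>y\<in>C v. N y i j)"
  proof (rule excess_cong)
    show "(\<Sum>w\<in>PiE V C. complex_of_real (Q w) * ?R w i j) = (\<Sum>v\<in>V. \<Sum>y\<in>C v. N y i j)" for i j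
      by (rule average_complex[where f = "\<lambda>y. N y i j"])
  qed
  finally show ?thesis .
qed

lemma average_le_obtain:
  assumes "(\<Sum>w\<in>PiE V C. Q w * f w) \<le> c"
  obtains w where "w \<in> PiE V C" "f w \<le> c"
proof -
  have False if "\<forall>w\<in>PiE V C. f w > c"
  proof -
    have ne: "PiE V C \<noteq> {}" using Q_sum by (metis sum.empty zero_neq_one)
    have "(\<Sum>w\<in>PiE V C. Q w * c) < (\<Sum>w\<in>PiE V C. Q w * f w)"
      using that Q_pos by (intro sum_strict_mono finite_W ne) simp
    then show False using assms by (simp add: sum_distrib_right[symmetric] Q_sum)
  qed
  then show thesis using that by (meson not_le)
qed

end

text \<open>The factorisation says that the law of X given \<open>y\<close> depends on
  \<open>y\<close> only through the label \<open>g y\<close>. The label is kept abstract because the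
  second use of the locale, on Alice's side, labels \<open>x\<close> by its law of the original Y
  and not of the merged one.\<close>

locale coarse_graining =
  fixes SX :: "'a set" and SY :: "'b set" and P :: "'a \<Rightarrow> 'b \<Rightarrow> real"
    and dA dB :: nat and psi :: "'a \<times> nat \<times> 'b \<times> nat \<Rightarrow> complex"
    and g :: "'b \<Rightarrow> 'c" and h :: "'c \<Rightarrow> 'a \<Rightarrow> real"
  assumes finX: "finite SX" and finY: "finite SY"
    and total: "(\<Sum>x\<in>SX. \<Sum>y\<in>SY. P x y) = 1"
    and emb: "is_embedding SX SY P dA dB psi"
    and factor: "\<And>x y. x \<in> SX \<Longrightarrow> y \<in> SY \<Longrightarrow> margY SX P y > 0 \<Longrightarrow> P x y = margY SX P y * h (g y) x"
begin

definition S where "S = {y \<in> SY. margY SX P y > 0}"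
definition V where "V = g ` S"
definition C where "C v = {y \<in> S. g y = v}"
definition P' where "P' x v = (\<Sum>y\<in>C v. P x y)"
definition pV where "pV v = (\<Sum>y\<in>C v. margY SX P y)"
text \<open>The probability of \<open>y\<close> given its class.\<close>

definition q where "q y = margY SX P y / pV (g y)"

lemma law: "has_law SX SY P dA dB psi"
  using emb is_embedding_iff[OF finX finY] by blast

lemma P_nonneg: "x \<in> SX \<Longrightarrow> y \<in> SY \<Longrightarrow> P x y \<ge> 0"
  using law unfolding has_law_def by (metis (no_types, lifting) sum_nonneg zero_le_power2)

lemma finS: "finite S" and S_sub: "S \<subseteq> SY" and finite_C: "finite (C v)"
  using finY by (auto simp: S_def C_def)

lemma finite_V: "finite V"
  using finS by (simp add: V_def)

lemma sum_classes: "(\<Sum>v\<in>V. \<Sum>y\<in>C v. f y) = (\<Sum>y\<in>S. f y)"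
  using sum.image_gen[OF finS, of f g] by (simp add: V_def C_def conj_commute)

lemma P_zero: "x \<in> SX \<Longrightarrow> y \<in> SY - S \<Longrightarrow> P x y = 0"
proof -
  assume x: "x \<in> SX" and y: "y \<in> SY - S"
  then have "margY SX P y \<le> 0" by (auto simp: S_def)
  moreover have nonneg: "\<And>x. x \<in> SX \<Longrightarrow> P x y \<ge> 0" using P_nonneg y by blast
  ultimately have "(\<Sum>x\<in>SX. P x y) = 0" unfolding margY_def by (meson antisym sum_nonneg)
  then show "P x y = 0" using sum_nonneg_eq_0_iff[OF finX, of "\<lambda>x. P x y"] nonneg x by blast
qed

lemma margY_zero: "y \<in> SY - S \<Longrightarrow> margY SX P y = 0"
  unfolding margY_def by (simp add: P_zero)

lemma sum_S: "(\<And>y. y \<in> SY - S \<Longrightarrow> f y = 0) \<Longrightarrow> (\<Sum>y\<in>S. f y) = (\<Sum>y\<in>SY. f y)"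
  by (rule sum.mono_neutral_left[OF finY S_sub]) blast

text \<open>Values of probability zero carry no amplitude, so restricting sums from
  \<open>SY\<close> to the support \<open>S\<close> changes no state.\<close>

lemma psi_zero:
  assumes "x \<in> SX" "a < dA" "y \<in> SY - S" "b < dB"
  shows "psi (x, a, y, b) = 0"
proof -
  have "(\<Sum>a<dA. \<Sum>b<dB. (cmod (psi (x, a, y, b)))\<^sup>2) = 0"
    using law P_zero[OF assms(1,3)] assms unfolding has_law_def by simp
  then have "\<forall>a\<in>{..<dA}. (\<Sum>b<dB. (cmod (psi (x, a, y, b)))\<^sup>2) = 0"
    by (subst (asm) sum_nonneg_eq_0_iff) (auto intro: sum_nonneg)
  then have "(\<Sum>b<dB. (cmod (psi (x, a, y, b)))\<^sup>2) = 0" using assms by blast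
  then have "\<forall>b\<in>{..<dB}. (cmod (psi (x, a, y, b)))\<^sup>2 = 0"
    by (subst (asm) sum_nonneg_eq_0_iff) auto
  then show ?thesis using assms by simp
qed

lemma cond_state_zero:
  assumes "x \<in> SX" "a < dA" "y \<in> SY - S"
  shows "cond_state dB psi y (x, a) j = 0"
  using psi_zero[OF assms] by (simp add: cond_state_def)

lemma pV_pos: assumes "y \<in> S" shows "pV (g y) > 0"
  unfolding pV_def using assms by (intro sum_pos2[OF finite_C, of y]) (auto simp: C_def S_def)

sublocale random_choice V C q
proof
  show "finite V" "finite (C v)" for v by (rule finite_V finite_C)+
  show "q y > 0" if "y \<in> C v" for v y
    using that pV_pos[of y] by (simp add: q_def C_def S_def)
  show "(\<Sum>y\<in>C v. q y) = 1" if "v \<in> V" for v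
  proof -
    obtain y where "y \<in> S" "v = g y" using \<open>v \<in> V\<close> by (auto simp: V_def)
    then have "pV v > 0" using pV_pos by blast
    moreover have "(\<Sum>y\<in>C v. q y) = (\<Sum>y\<in>C v. margY SX P y) / pV v"
      unfolding sum_divide_distrib by (intro sum.cong refl) (simp add: q_def C_def)
    ultimately show ?thesis by (simp add: pV_def)
  qed
qed

lemma class_factor: "x \<in> SX \<Longrightarrow> y \<in> C v \<Longrightarrow> P x y = margY SX P y * h v x"
  using factor[of x y] by (auto simp: C_def S_def)

lemma P'_factor: "x \<in> SX \<Longrightarrow> P' x v = pV v * h v x"
  by (simp add: P'_def pV_def sum_distrib_right class_factor)

lemma margX_P': "x \<in> SX \<Longrightarrow> margX V P' x = margX SY P x"
  unfolding margX_def P'_def sum_classes by (rule sum_S) (rule P_zero)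

lemma margY_P': "margY SX P' v = pV v"
  unfolding margY_def P'_def pV_def by (rule sum.swap)

lemma total_P': "(\<Sum>x\<in>SX. \<Sum>v\<in>V. P' x v) = 1"
  using margX_P' total by (simp add: margX_def)

lemma shannon_mi_P': "shannon_mi SX V P' = shannon_mi SX SY P"
proof -
  define K where "K v = (\<Sum>x\<in>SX. ent_term (h v x))" for v
  \<comment> \<open>A column proportional to \<open>h v\<close> contributes linearly in its weight
    \<open>t\<close>, so the contributions of a class add up to that of the merged column.\<close>
  have col: "ent_term t - (\<Sum>x\<in>SX. ent_term (t * h v x)) = - t * K v"
    if v: "v \<in> V" and t: "t \<ge> 0" for v t
  proof -
    obtain y where y: "y \<in> C v" using v by (auto simp: V_def C_def)
    then have pos: "margY SX P y > 0" and ySY: "y \<in> SY" by (auto simp: C_def S_def)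
    have h0: "h v x \<ge> 0" if "x \<in> SX" for x
      using class_factor[OF that y] P_nonneg[OF that ySY] pos by (simp add: zero_le_mult_iff)
    have "margY SX P y = margY SX P y * (\<Sum>x\<in>SX. h v x)"
      unfolding sum_distrib_left using class_factor[OF _ y] by (simp add: margY_def)
    then have "(\<Sum>x\<in>SX. h v x) = 1" using pos by simp
    then show ?thesis
      using h0 t by (simp add: ent_term_mult K_def sum.distrib sum_distrib_left[symmetric]
          sum_distrib_right[symmetric])
  qed
  have "(\<Sum>y\<in>SY. ent_term (margY SX P y) - (\<Sum>x\<in>SX. ent_term (P x y)))
      = (\<Sum>y\<in>S. ent_term (margY SX P y) - (\<Sum>x\<in>SX. ent_term (P x y)))"
    by (rule sum_S[symmetric]) (simp add: margY_zero P_zero ent_term_def)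
  also have "\<dots> = (\<Sum>v\<in>V. \<Sum>y\<in>C v. ent_term (margY SX P y) - (\<Sum>x\<in>SX. ent_term (P x y)))"
    by (rule sum_classes[symmetric])
  also have "\<dots> = (\<Sum>v\<in>V. \<Sum>y\<in>C v. - margY SX P y * K v)"
  proof (intro sum.cong refl)
    fix v y assume v: "v \<in> V" and y: "y \<in> C v"
    have "margY SX P y \<ge> 0" using y by (auto simp: C_def S_def)
    from col[OF v this] show "ent_term (margY SX P y) - (\<Sum>x\<in>SX. ent_term (P x y)) = - margY SX P y * K v"
      by (simp add: class_factor[OF _ y])
  qed
  also have "\<dots> = (\<Sum>v\<in>V. - pV v * K v)"
    by (simp add: pV_def sum_distrib_right sum_negf)
  also have "\<dots> = (\<Sum>v\<in>V. ent_term (margY SX P' v) - (\<Sum>x\<in>SX. ent_term (P' x v)))"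
  proof (intro sum.cong refl)
    fix v assume v: "v \<in> V"
    have "pV v \<ge> 0" using v pV_pos by (auto simp: V_def less_imp_le)
    from col[OF v this] show "- pV v * K v = ent_term (margY SX P' v) - (\<Sum>x\<in>SX. ent_term (P' x v))"
      by (simp add: margY_P' P'_factor)
  qed
  finally have "(\<Sum>y\<in>SY. ent_term (margY SX P y) - (\<Sum>x\<in>SX. ent_term (P x y)))
      = (\<Sum>v\<in>V. ent_term (margY SX P' v) - (\<Sum>x\<in>SX. ent_term (P' x v)))" .
  then have "(\<Sum>y\<in>SY. ent_term (margY SX P y)) - (\<Sum>x\<in>SX. \<Sum>y\<in>SY. ent_term (P x y))
      = (\<Sum>v\<in>V. ent_term (margY SX P' v)) - (\<Sum>x\<in>SX. \<Sum>v\<in>V. ent_term (P' x v))"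
    unfolding sum_subtractf by (simp only: sum.swap[of _ SX])
  then show ?thesis unfolding shannon_mi_def by (simp add: margX_P')
qed

text \<open>Dividing by the root of \<open>q\<close> raises the weight of the branch
  \<open>w v\<close> from \<open>margY SX P (w v)\<close> to the mass \<open>pV v\<close> of the
  whole class.\<close>

definition phi :: "('c \<Rightarrow> 'b) \<Rightarrow> 'a \<times> nat \<times> 'c \<times> nat \<Rightarrow> complex" where
  "phi w = (\<lambda>(x, a, v, b). psi (x, a, w v, b) / complex_of_real (sqrt (q (w v))))"

lemma scaled_product:
  assumes "r > 0"
  shows "(z / complex_of_real (sqrt r)) * cnj (z' / complex_of_real (sqrt r))
    = complex_of_real (1 / r) * (z * cnj z')"
proof -
  have "complex_of_real (sqrt r) * complex_of_real (sqrt r) = complex_of_real r"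
    using assms by (simp flip: of_real_mult)
  then show ?thesis by simp
qed

lemma cond_state_phi:
  assumes "w \<in> PiE V C" "v \<in> V"
  shows "cond_state dB (phi w) v i j = complex_of_real (1 / q (w v)) * cond_state dB psi (w v) i j"
  unfolding cond_state_def phi_def prod.case scaled_product[OF W_component_pos[OF assms]]
  by (simp only: sum_distrib_left)

lemma cond_state_phi_swap:
  assumes "w \<in> PiE V C" "v \<in> V"
  shows "cond_state dA (swap_regs (phi w)) x (v, b) (v, b')
    = complex_of_real (1 / q (w v)) * cond_state dA (swap_regs psi) x (w v, b) (w v, b')"
  unfolding cond_state_def phi_def fst_conv snd_conv swap_regs_apply prod.case
    scaled_product[OF W_component_pos[OF assms]]
  by (simp only: sum_distrib_left)

text \<open>The kept branch has a law proportional to \<open>h v\<close>, like every other branch of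
  its class, so only the total mass has to match, and \<open>phi\<close> is scaled for that.\<close>

lemma has_law_phi:
  assumes w: "w \<in> PiE V C"
  shows "has_law SX V P' dA dB (phi w)"
  unfolding has_law_def
proof (intro ballI)
  fix x v assume x: "x \<in> SX" and v: "v \<in> V"
  have wv: "w v \<in> C v" using w v by (auto simp: PiE_def Pi_def)
  then have wS: "w v \<in> SY" "margY SX P (w v) > 0" "g (w v) = v" "w v \<in> S" by (auto simp: C_def S_def)
  have "(\<Sum>a<dA. \<Sum>b<dB. (cmod (phi w (x, a, v, b)))\<^sup>2)
      = (\<Sum>a<dA. \<Sum>b<dB. (cmod (psi (x, a, w v, b)))\<^sup>2) / q (w v)"
    using W_component_pos[OF w v]
    by (simp add: phi_def norm_divide power_divide sum_divide_distrib)
  also have "\<dots> = P x (w v) / q (w v)" using law x wS unfolding has_law_def by simp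
  also have "\<dots> = P' x v"
    using wS pV_pos[OF wS(4)] by (simp add: class_factor[OF x wv] P'_factor[OF x] q_def)
  finally show "(\<Sum>a<dA. \<Sum>b<dB. (cmod (phi w (x, a, v, b)))\<^sup>2) = P' x v" .
qed

section \<open>The sampled states as embeddings of the merged primitive\<close>

abbreviation e where "e x y \<equiv> excess {..<dA} (\<lambda>a a'. cond_state dB psi y (x, a) (x, a'))"

lemma e_zero: assumes "x \<in> SX" "y \<in> SY - S" shows "e x y = 0"
proof -
  have "e x y = excess {..<dA} (\<lambda>a a'. complex_of_real 0 * cond_state dB psi y (x, a) (x, a'))"
    using cond_state_zero[OF assms(1) _ assms(2)] by (intro excess_cong) simp
  also have "\<dots> = 0" by (subst excess_scale) (simp_all add: psd_cond_state_x)
  finally show ?thesis .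
qed

lemma e_phi:
  assumes "w \<in> PiE V C" "v \<in> V"
  shows "excess {..<dA} (\<lambda>a a'. cond_state dB (phi w) v (x, a) (x, a')) = (1 / q (w v)) * e x (w v)"
  unfolding cond_state_phi[OF assms] using W_component_pos[OF assms]
  by (intro excess_scale psd_cond_state_x) simp_all

text \<open>The embedding condition equates only the sums over \<open>x\<close>, but superadditivity
  orders the two terms for each \<open>x\<close>, so they are equal one by one.\<close>

lemma excess_x:
  assumes x: "x \<in> SX"
  shows "excess {..<dA} (\<lambda>a a'. \<Sum>y\<in>SY. cond_state dB psi y (x, a) (x, a')) = (\<Sum>y\<in>SY. e x y)"
proof -
  have eq: "(\<Sum>x\<in>SX. \<Sum>y\<in>SY. e x y) = (\<Sum>x\<in>SX. excess {..<dA} (\<lambda>a a'. \<Sum>y\<in>SY. cond_state dB psi y (x, a) (x, a')))"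
    using emb is_embedding_iff[OF finX finY] by (simp add: excess_X_def excess_XY_def)
  have le: "(\<Sum>y\<in>SY. e x y) \<le> excess {..<dA} (\<lambda>a a'. \<Sum>y\<in>SY. cond_state dB psi y (x, a) (x, a'))" for x
    by (intro excess_superadditive finY psd_cond_state_x) simp
  show ?thesis by (rule sum_mono_inv[OF eq le x finX, symmetric])
qed

lemma excess_y:
  assumes y: "y \<in> SY"
  shows "excess {..<dB} (\<lambda>b b'. \<Sum>x\<in>SX. cond_state dA (swap_regs psi) x (y, b) (y, b'))
    = (\<Sum>x\<in>SX. excess {..<dB} (\<lambda>b b'. cond_state dA (swap_regs psi) x (y, b) (y, b')))"
    (is "?l y = ?r y")
proof -
  have eq: "(\<Sum>y\<in>SY. ?r y) = (\<Sum>y\<in>SY. ?l y)"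
    using emb is_embedding_iff[OF finX finY] excess_XY_swap[of SX dA SY dB psi]
    by (simp add: excess_X_def excess_XY_def)
  have le: "?r y \<le> ?l y" for y
    by (intro excess_superadditive finX psd_cond_state_x) simp
  show ?thesis by (rule sum_mono_inv[OF eq le y finY, symmetric])
qed

text \<open>The inequality \<open>\<ge>\<close> holds for every \<open>w\<close> and is an equality on average.\<close>
lemma excess_X_phi:
  assumes w: "w \<in> PiE V C"
  shows "excess_X SX dA V dB (phi w) = excess_XY SX dA V dB (phi w)"
  unfolding excess_X_def excess_XY_def
proof (intro sum.cong refl)
  fix x assume x: "x \<in> SX"
  define l where "l w = excess {..<dA} (\<lambda>a a'. \<Sum>v\<in>V. complex_of_real (1 / q (w v)) * cond_state dB psi (w v) (x, a) (x, a'))" for w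
  define r where "r w = (\<Sum>v\<in>V. (1 / q (w v)) * e x (w v))" for w
  have l: "excess {..<dA} (\<lambda>a a'. \<Sum>v\<in>V. cond_state dB (phi w) v (x, a) (x, a')) = l w"
    if "w \<in> PiE V C" for w
    unfolding l_def by (intro excess_cong sum.cong refl cond_state_phi[OF that])
  have r: "(\<Sum>v\<in>V. excess {..<dA} (\<lambda>a a'. cond_state dB (phi w) v (x, a) (x, a'))) = r w"
    if "w \<in> PiE V C" for w
    unfolding r_def by (intro sum.cong refl e_phi[OF that])
  have rl: "r w \<le> l w" if "w \<in> PiE V C" for w
    unfolding l[OF that, symmetric] r[OF that, symmetric]
    by (intro excess_superadditive finite_V psd_cond_state_x) simp
  have "(\<Sum>w\<in>PiE V C. Q w * l w)
      \<le> excess {..<dA} (\<lambda>a a'. \<Sum>v\<in>V. \<Sum>y\<in>C v. cond_state dB psi y (x, a) (x, a'))"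
    unfolding l_def by (rule average_excess[where N = "\<lambda>y a a'. cond_state dB psi y (x, a) (x, a')"])
      (simp_all add: psd_cond_state_x)
  also have "\<dots> = excess {..<dA} (\<lambda>a a'. \<Sum>y\<in>SY. cond_state dB psi y (x, a) (x, a'))"
    unfolding sum_classes using cond_state_zero[OF x] by (intro excess_cong sum_S) simp
  also have "\<dots> = (\<Sum>y\<in>S. e x y)" unfolding excess_x[OF x] by (rule sum_S[symmetric]) (rule e_zero[OF x])
  \<comment> \<open>\<open>r\<close> is a sum over branches, so its average is exact, and the chain
    bounds the average of \<open>l\<close> by that of \<open>r\<close>.\<close>
  also have "\<dots> = (\<Sum>w\<in>PiE V C. Q w * r w)" unfolding r_def average_real[where f = "e x"] sum_classes ..
  finally have "(\<Sum>w\<in>PiE V C. Q w * l w) \<le> (\<Sum>w\<in>PiE V C. Q w * r w)" .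
  moreover have Qrl: "Q w * r w \<le> Q w * l w" if "w \<in> PiE V C" for w
    using rl[OF that] Q_pos[OF that] by simp
  ultimately have "(\<Sum>w\<in>PiE V C. Q w * r w) = (\<Sum>w\<in>PiE V C. Q w * l w)"
    using sum_mono[of "PiE V C", OF Qrl] by (intro antisym) simp_all
  \<comment> \<open>The termwise bound \<open>r w \<le> l w\<close>, equal averages and positive
    weights force equality for every single choice.\<close>
  from sum_mono_inv[OF this Qrl w finite_W] have "r w = l w" using Q_pos[OF w] by simp
  then show "excess {..<dA} (\<lambda>a a'. \<Sum>v\<in>V. cond_state dB (phi w) v (x, a) (x, a'))
      = (\<Sum>v\<in>V. excess {..<dA} (\<lambda>a a'. cond_state dB (phi w) v (x, a) (x, a')))"
    using l[OF w] r[OF w] by simp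
qed

text \<open>No averaging enters here: the merged value \<open>v\<close> stands for the single branch
  \<open>w v\<close>, so additivity over \<open>x\<close> is inherited from \<open>excess_y\<close>
  by scaling.\<close>

lemma excess_X_phi_swap:
  assumes w: "w \<in> PiE V C"
  shows "excess_X V dB SX dA (swap_regs (phi w)) = excess_XY SX dA V dB (phi w)"
  unfolding excess_XY_swap[of SX] unfolding excess_X_def excess_XY_def
proof (intro sum.cong refl)
  fix v assume v: "v \<in> V"
  have wv: "w v \<in> SY" using w v by (auto simp: PiE_def Pi_def C_def S_def)
  have q0: "1 / q (w v) \<ge> 0" using W_component_pos[OF w v] by simp
  let ?N = "\<lambda>x b b'. cond_state dA (swap_regs psi) x (w v, b) (w v, b')"
  have "excess {..<dB} (\<lambda>b b'. \<Sum>x\<in>SX. cond_state dA (swap_regs (phi w)) x (v, b) (v, b'))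
      = excess {..<dB} (\<lambda>b b'. complex_of_real (1 / q (w v)) * (\<Sum>x\<in>SX. ?N x b b'))"
    unfolding cond_state_phi_swap[OF w v] by (simp only: sum_distrib_left)
  also have "\<dots> = (1 / q (w v)) * excess {..<dB} (\<lambda>b b'. \<Sum>x\<in>SX. ?N x b b')"
    by (intro excess_scale psd_sum psd_cond_state_x q0) simp
  also have "\<dots> = (\<Sum>x\<in>SX. (1 / q (w v)) * excess {..<dB} (?N x))"
    unfolding excess_y[OF wv] by (simp only: sum_distrib_left)
  also have "\<dots> = (\<Sum>x\<in>SX. excess {..<dB} (\<lambda>b b'. cond_state dA (swap_regs (phi w)) x (v, b) (v, b')))"
    unfolding cond_state_phi_swap[OF w v]
    by (intro sum.cong refl excess_scale[symmetric] psd_cond_state_x q0) simp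
  finally show "excess {..<dB} (\<lambda>b b'. \<Sum>x\<in>SX. cond_state dA (swap_regs (phi w)) x (v, b) (v, b'))
      = (\<Sum>x\<in>SX. excess {..<dB} (\<lambda>b b'. cond_state dA (swap_regs (phi w)) x (v, b) (v, b')))" .
qed

lemma is_embedding_phi:
  assumes w: "w \<in> PiE V C"
  shows "is_embedding SX V P' dA dB (phi w)"
  unfolding is_embedding_iff[OF finX finite_V]
  using emb is_embedding_iff[OF finX finY] has_law_phi[OF w] excess_X_phi[OF w] excess_X_phi_swap[OF w]
  by blast

text \<open>By \<open>emb_leakage_eq\<close> the leakage is a concave term, minus a term additive
  over the branches, minus the mutual information, which merging preserves. Hence the average
  leakage of \<open>phi w\<close> is at most that of \<open>psi\<close>, and some choice
  \<open>w\<close> attains this bound.\<close>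

lemma embedding_coarse:
  "\<exists>phi. is_embedding SX V P' dA dB phi \<and>
     emb_leakage SX V P' dA dB phi \<le> emb_leakage SX SY P dA dB psi"
proof -
  define l where "l w = excess (SX \<times> {..<dA}) (\<lambda>i j. \<Sum>v\<in>V. complex_of_real (1 / q (w v)) * cond_state dB psi (w v) i j)" for w
  define r where "r w = (\<Sum>x\<in>SX. \<Sum>v\<in>V. (1 / q (w v)) * e x (w v))" for w
  have l: "excess_AA SX dA V dB (phi w) = l w" if "w \<in> PiE V C" for w
    unfolding excess_AA_def l_def by (intro excess_cong sum.cong refl cond_state_phi[OF that])
  have r: "excess_XY SX dA V dB (phi w) = r w" if "w \<in> PiE V C" for w
    unfolding excess_XY_def r_def by (intro sum.cong refl e_phi[OF that])
  have "(\<Sum>w\<in>PiE V C. Q w * l w)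
      \<le> excess (SX \<times> {..<dA}) (\<lambda>i j. \<Sum>v\<in>V. \<Sum>y\<in>C v. cond_state dB psi y i j)"
    unfolding l_def by (intro average_excess psd_cond_state) (simp add: finX)
  also have "\<dots> = excess_AA SX dA SY dB psi"
    unfolding sum_classes excess_AA_def using cond_state_zero by (intro excess_cong sum_S) auto
  finally have "(\<Sum>w\<in>PiE V C. Q w * l w) \<le> excess_AA SX dA SY dB psi" .
  moreover have "(\<Sum>w\<in>PiE V C. Q w * r w) = excess_XY SX dA SY dB psi"
  proof -
    have "(\<Sum>w\<in>PiE V C. Q w * r w) = (\<Sum>x\<in>SX. \<Sum>w\<in>PiE V C. Q w * (\<Sum>v\<in>V. (1 / q (w v)) * e x (w v)))"
      unfolding r_def sum_distrib_left[of "Q _" _ SX] by (rule sum.swap)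
    also have "\<dots> = (\<Sum>x\<in>SX. \<Sum>y\<in>SY. e x y)"
    proof (intro sum.cong refl)
      fix x assume "x \<in> SX"
      then show "(\<Sum>w\<in>PiE V C. Q w * (\<Sum>v\<in>V. (1 / q (w v)) * e x (w v))) = (\<Sum>y\<in>SY. e x y)"
        unfolding average_real[where f = "e x"] sum_classes by (intro sum_S e_zero)
    qed
    finally show ?thesis by (simp only: excess_XY_def)
  qed
  ultimately have "(\<Sum>w\<in>PiE V C. Q w * (l w - r w)) \<le> excess_AA SX dA SY dB psi - excess_XY SX dA SY dB psi"
    by (simp add: right_diff_distrib sum_subtractf)
  then obtain w where w: "w \<in> PiE V C" and le: "l w - r w \<le> excess_AA SX dA SY dB psi - excess_XY SX dA SY dB psi"
    by (rule average_le_obtain)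
  show ?thesis
    using is_embedding_phi[OF w] le
    unfolding emb_leakage_eq[OF finX finY total emb]
      emb_leakage_eq[OF finX finite_V total_P' is_embedding_phi[OF w]] shannon_mi_P' l[OF w, symmetric] r[OF w, symmetric]
    by (intro exI[of _ "phi w"]) (simp add: emb_leakage_eq[OF finX finite_V total_P' is_embedding_phi[OF w]] shannon_mi_P')
qed

end

section \<open>Dependent part\<close>

lemma excess_singleton:
  assumes "psd {j} M"
  shows "excess {j} M = 0"
proof -
  have "Im (M j j) = 0" using assms by (auto simp: psd_def hermitian_on_def complex_eq_iff)
  moreover have "Re (qform {j} M (\<lambda>_. 1)) \<ge> 0" using assms by (simp add: psd_def)
  then have "Re (M j j) \<ge> 0" by (simp add: qform_def)
  ultimately show ?thesis by (simp add: excess_def vn_entropy_singleton)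
qed

text \<open>With trivial work spaces every excess in \<open>is_embedding_iff\<close> is a sum over
  one by one matrices and vanishes. The lemma shows that the set of leakages is nonempty.\<close>

lemma is_embedding_canonical:
  assumes "primitive SX SY P"
  shows "is_embedding SX SY P 1 1 (\<lambda>(x, _, y, _). complex_of_real (sqrt (P x y)))"
proof -
  have one: "{..<1::nat} = {0}" by auto
  have fin: "finite SX" "finite SY" and P: "\<forall>x\<in>SX. \<forall>y\<in>SY. P x y \<ge> 0"
    using assms by (auto simp: primitive_def)
  show ?thesis
    unfolding is_embedding_iff[OF fin] excess_X_def excess_XY_def has_law_def one
    using P by (simp add: excess_singleton psd_sum psd_cond_state_x)
qed

lemma emb_leakage_swap:
  "emb_leakage SY SX (\<lambda>y x. P x y) dB dA (swap_regs psi) = emb_leakage SX SY P dA dB psi"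
  unfolding emb_leakage_def shannon_mi_transpose[of SY SX P] S_X_BB'_swap
  by (simp add: max.commute)

text \<open>The embedding condition and the Schmidt decomposition turn \<open>excess_XY\<close> into
  S(AA'|Y), which is at most S(AA') by concavity. The bound is crude, but it makes the set of
  leakages bounded below.\<close>

lemma emb_leakage_lower_bound:
  assumes fin: "finite SX" "finite SY" and total: "(\<Sum>x\<in>SX. \<Sum>y\<in>SY. P x y) = 1"
    and emb: "is_embedding SX SY P dA dB psi"
  shows "- shannon_mi SX SY P \<le> emb_leakage SX SY P dA dB psi"
proof -
  have "excess_XY SX dA SY dB psi = excess_X SY dB SX dA (swap_regs psi)"
    using emb by (simp add: is_embedding_iff[OF fin])
  also have "\<dots> = (\<Sum>y\<in>SY. excess (SX \<times> {..<dA}) (cond_state dB psi y))"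
    by (simp only: excess_X_def excess_AA_cond_state[OF fin(1)])
  also have "\<dots> \<le> excess_AA SX dA SY dB psi"
    unfolding excess_AA_def by (intro excess_superadditive psd_cond_state) (simp_all add: fin)
  finally show ?thesis by (simp add: emb_leakage_eq[OF fin total emb])
qed

text \<open>Two rounds of merging: first the values of Y, then, with the parties swapped, the values
  of X. The work spaces keep their dimensions.\<close>

lemma dependent_part_embedding:
  assumes prim: "primitive SX SY P" and emb: "is_embedding SX SY P dA dB psi"
  defines "U \<equiv> depX_set SX SY P" and "V \<equiv> depY_set SX SY P" and "D \<equiv> dep_dist SX SY P"
  shows "(\<Sum>u\<in>U. \<Sum>v\<in>V. D u v) = 1 \<and>
    (\<exists>phi. is_embedding U V D dA dB phi \<and> emb_leakage U V D dA dB phi \<le> emb_leakage SX SY P dA dB psi)"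
proof -
  have fin: "finite SX" "finite SY" and total: "(\<Sum>x\<in>SX. \<Sum>y\<in>SY. P x y) = 1"
    using prim by (auto simp: primitive_def)
  \<comment> \<open>The label of \<open>y\<close> is its conditional law itself, so
    \<open>h v = v\<close>.\<close>
  interpret c1: coarse_graining SX SY P dA dB psi "condX SX P" "\<lambda>v x. v x"
    by unfold_locales (use fin total emb in \<open>auto simp: condX_def\<close>)
  obtain phi1 where phi1: "is_embedding SX c1.V c1.P' dA dB phi1"
    "emb_leakage SX c1.V c1.P' dA dB phi1 \<le> emb_leakage SX SY P dA dB psi"
    using c1.embedding_coarse by blast
  have marg: "margY c1.V (\<lambda>v x. c1.P' x v) x = margX SY P x" if "x \<in> SX" for x
    unfolding margY_transpose[of c1.V c1.P'] by (rule c1.margX_P'[OF that])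
  \<comment> \<open>The label \<open>u\<close> of \<open>x\<close> is a law on the original values
    of Y; the merged value \<open>v\<close> then has the probability that \<open>u\<close> gives to
    the class \<open>c1.C v\<close>.\<close>
  interpret c2: coarse_graining c1.V SX "\<lambda>v x. c1.P' x v" dB dA "swap_regs phi1" "condY SY P"
    "\<lambda>u v. \<Sum>y\<in>c1.C v. u y"
  proof
    show "finite c1.V" "finite SX" by (fact c1.finite_V fin)+
    show "(\<Sum>v\<in>c1.V. \<Sum>x\<in>SX. c1.P' x v) = 1" using c1.total_P' by (subst sum.swap)
    show "is_embedding c1.V SX (\<lambda>v x. c1.P' x v) dB dA (swap_regs phi1)"
      by (rule is_embedding_swap[OF fin(1) c1.finite_V phi1(1)])
    fix v x assume x: "x \<in> SX" and "margY c1.V (\<lambda>v x. c1.P' x v) x > 0"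
    then have "margX SY P x > 0" by (simp add: marg)
    then show "c1.P' x v = margY c1.V (\<lambda>v x. c1.P' x v) x * (\<Sum>y\<in>c1.C v. condY SY P x y)"
      unfolding c1.P'_def[of x v] marg[OF x] sum_distrib_left
      by (intro sum.cong refl) (auto simp: condY_def c1.C_def c1.S_def)
  qed
  obtain phi2 where phi2: "is_embedding c1.V c2.V c2.P' dB dA phi2"
    "emb_leakage c1.V c2.V c2.P' dB dA phi2 \<le> emb_leakage c1.V SX (\<lambda>v x. c1.P' x v) dB dA (swap_regs phi1)"
    using c2.embedding_coarse by blast
  have V: "c1.V = V" by (simp add: c1.V_def c1.S_def V_def depY_set_def)
  \<comment> \<open>The first round leaves the marginal of X unchanged, so the support is the one in
    \<open>depX_set_def\<close>.\<close>
  have S2: "c2.S = {x \<in> SX. margX SY P x > 0}" by (auto simp: c2.S_def marg)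
  have U: "c2.V = U" by (simp add: c2.V_def S2 U_def depX_set_def)
  have D: "(\<lambda>u v. c2.P' v u) = D"
  proof (intro ext)
    fix u v
    have C2: "c2.C u = {x \<in> SX. margX SY P x > 0 \<and> condY SY P x = u}"
      and C1: "c1.C v = {y \<in> SY. margY SX P y > 0 \<and> condX SX P y = v}"
      unfolding c2.C_def c1.C_def S2 c1.S_def by blast+
    have "c2.P' v u = (\<Sum>x | x \<in> SX \<and> margX SY P x > 0 \<and> condY SY P x = u. c1.P' x v)"
      unfolding c2.P'_def[of v u] C2 ..
    also have "\<dots> = D u v"
      unfolding c1.P'_def C1 D_def dep_dist_def ..
    finally show "c2.P' v u = D u v" .
  qed
  have "is_embedding U V D dA dB (swap_regs phi2)"
    using is_embedding_swap[OF c1.finite_V c2.finite_V phi2(1)] unfolding U D unfolding V .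
  moreover have "emb_leakage U V D dA dB (swap_regs phi2) = emb_leakage c1.V c2.V c2.P' dB dA phi2"
    using emb_leakage_swap[of c2.V c1.V c2.P' dA dB phi2] unfolding U D unfolding V .
  moreover have "(\<Sum>u\<in>U. \<Sum>v\<in>V. D u v) = 1"
    using c2.total_P' unfolding D[symmetric] U unfolding V by (subst sum.swap)
  ultimately show ?thesis using phi1(2) phi2(2) emb_leakage_swap[of c1.V SX c1.P' dB dA phi1]
    by (intro conjI exI[of _ "swap_regs phi2"]) auto
qed

theorem theorem2:
  fixes SX :: "'a set" and SY :: "'b set" and P :: "'a \<Rightarrow> 'b \<Rightarrow> real"
  assumes "primitive SX SY P"
  shows "prim_leakage SX SY P \<ge>
         prim_leakage (depX_set SX SY P) (depY_set SX SY P) (dep_dist SX SY P)"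
  unfolding prim_leakage_def
\<comment> \<open>Each embedding of \<open>P\<close> yields one of the dependent part with at most
  the same leakage. The other two goals exclude the unspecified values of the real
  \<open>Inf\<close> on empty or unbounded sets.\<close>
proof (rule cInf_mono)
  show "{emb_leakage SX SY P dA dB psi | dA dB psi. is_embedding SX SY P dA dB psi} \<noteq> {}"
    using is_embedding_canonical[OF assms] by blast
  have fin: "finite (depX_set SX SY P)" "finite (depY_set SX SY P)"
    using assms by (simp_all add: primitive_def depX_set_def depY_set_def)
  have "(\<Sum>u\<in>depX_set SX SY P. \<Sum>v\<in>depY_set SX SY P. dep_dist SX SY P u v) = 1"
    using dependent_part_embedding[OF assms is_embedding_canonical[OF assms]] by blast
  from emb_leakage_lower_bound[OF fin this]
  show "bdd_below {emb_leakage (depX_set SX SY P) (depY_set SX SY P) (dep_dist SX SY P) dA dB psi | dA dB psi.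
      is_embedding (depX_set SX SY P) (depY_set SX SY P) (dep_dist SX SY P) dA dB psi}"
    by (intro bdd_belowI[where m = "- shannon_mi (depX_set SX SY P) (depY_set SX SY P) (dep_dist SX SY P)"]) blast
qed (use dependent_part_embedding[OF assms] in blast)

end
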